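(* Let $V\subset\mathbb{R}\times C_n$ be open and let $g:V\to\mathbb{R}^n$ be $C^1_{\ast}$-smooth. For all $(t_0,\phi)\in V$, $(t_0,t_0,\phi)\in dom$ and $P(t_0,t_0,\phi)=\phi$, and for all $t_0\le t\le s$ with $(t,t_0,\phi)\in dom$ and $(s,t,P(t,t_0,\phi))\in dom$, $$(s,t_0,\phi)\in dom\quad\text{and}\quad P(s,t_0,\phi)=P(s,t,P(t,t_0,\phi)).$$
   Context: For $m\in\mathbb{N}$, $C_m=C((-\infty,0],\mathbb{R}^m)$ is the Fréchet space of continuous maps $(-\infty,0]\to\mathbb{R}^m$ with the topology of locally uniform convergence. Fix $n\in\mathbb{N}$. The symbol $\ast$ is either $MB$ or $F$ (the result holds in each case). Smoothness: Let $X,W$ be topological vector spaces, $O\subset X$ open, $h:O\to W$ continuous, $Dh(u)v=\lim_{0\neq t\to0}\frac1t(h(u+tv)-h(u))$. The map $h$ is $C^1_{MB}$-smooth if all directional derivatives exist and $O\times X\ni(u,v)\mapsto Dh(u)v\in W$ is continuous. It is $C^1_F$-smooth if all directional derivatives exist, each $Dh(u):X\to W$ is linear and continuous, and $O\ni u\mapsto Dh(u)\in L_c(X,W)$ is continuous with respect to the topology of uniform convergence on bounded sets on the space $L_c(X,W)$ of continuous linear maps. For $t\in\mathbb{R}$ define $t_{\ast}\in C_1$ by $t_{\ast}(u)=t+u$. Identify $C_{n+1}=C_1\times C_n$, let $\psi_1$ denote the first component of $\psi\in C_{n+1}$, and let $p_n:C_{n+1}\to C_n$ be the continuous linear map forgetting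 the first component. Set $U_g=\{\psi\in C_{n+1}:(\psi_1(0),p_n\psi)\in V\}$ and $f_g:U_g\to\mathbb{R}^{n+1}$, $f_g(\psi)=(1,g(\psi_1(0),p_n\psi))$. Segments: $y_t(s)=y(t+s)$, $s\le0$. A solution of $y'(t)=f_g(y_t)$ on an interval $I$ is a continuous map $y:(-\infty,0]+I\to\mathbb{R}^{n+1}$ with $y_t\in U_g$ for all $t\in I$, $y|_I$ differentiable, and $y'(t)=f_g(y_t)$ for all $t\in I$ (one-sided derivatives at endpoints belonging to $I$). For each $\psi\in U_g$ there is a unique maximal solution $y^{\psi}$ on some interval $[0,t_\psi)$, $0<t_\psi\le\infty$, with $y^\psi_0=\psi$. Set $\Omega_g=\{(t,\psi)\in[0,\infty)\times U_g:t<t_\psi\}$ and $\Sigma_g:\Omega_g\to U_g$, $\Sigma_g(t,\psi)=y^\psi_t$. Finally $$dom=\{(t,t_0,\phi)\in\mathbb{R}^2\times C_n:t_0\le t,\ (t-t_0,t_{0\ast},\phi)\in\Omega_g\},\qquad P:dom\to C_n,\ P(t,t_0,\phi)=p_n\Sigma_g(t-t_0,t_{0\ast},\phi),$$ where $(s,t_{0\ast},\phi)$ stands for $(s,(t_{0\ast},\phi))\in[0,\infty)\times C_{n+1}$. *)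

theory Defs
  imports "HOL-Analysis.Analysis"
begin

section \<open>Topological vector spaces and the two notions of smoothness\<close>

class topological_real_vector = real_vector + topological_ab_group_add + t2_space +
  assumes tendsto_scaleR_Pair:
    "LIM x (nhds a \<times>\<^sub>F nhds b). fst x *\<^sub>R snd x :> nhds (a *\<^sub>R b)"

instance real_normed_vector < topological_real_vector
proof
  fix a :: real and b :: 'a
  show "LIM x (nhds a \<times>\<^sub>F nhds b). fst x *\<^sub>R snd x :> nhds (a *\<^sub>R b)"
    by (intro tendsto_scaleR filterlim_fst filterlim_snd)
qed

lemma tendsto_scaleR_tvs:
  fixes b :: "'a::topological_real_vector"
  assumes "(f \<longlongrightarrow> a) F" and "(g \<longlongrightarrow> b) F"
  shows "((\<lambda>x. f x *\<^sub>R g x) \<longlongrightarrow> a *\<^sub>R b) F"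
  using filterlim_compose[OF tendsto_scaleR_Pair filterlim_Pair[OF assms]] by simp

instance prod :: (topological_monoid_add, topological_monoid_add) topological_monoid_add
proof
  fix a b :: "'a \<times> 'b"
  have 1: "((\<lambda>x. x) \<longlongrightarrow> a) (nhds a)" and 2: "((\<lambda>x. x) \<longlongrightarrow> b) (nhds b)"
    by (auto intro: filterlim_ident)
  have f: "(fst \<longlongrightarrow> a) (nhds a \<times>\<^sub>F nhds b)" "(snd \<longlongrightarrow> b) (nhds a \<times>\<^sub>F nhds b)"
    by (rule filterlim_fst, rule filterlim_snd)
  have "((\<lambda>x. (fst (fst x) + fst (snd x), snd (fst x) + snd (snd x)))
          \<longlongrightarrow> (fst a + fst b, snd a + snd b)) (nhds a \<times>\<^sub>F nhds b)"
    by (intro tendsto_Pair tendsto_add tendsto_fst tendsto_snd f)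
  then show "LIM x (nhds a \<times>\<^sub>F nhds b). fst x + snd x :> nhds (a + b)"
    by (simp add: plus_prod_def)
qed

instance prod :: (topological_group_add, topological_group_add) topological_group_add
proof
  fix a :: "'a \<times> 'b"
  have f: "((\<lambda>x. x) \<longlongrightarrow> a) (nhds a)"
    by (rule filterlim_ident)
  have "((\<lambda>x. (- fst x, - snd x)) \<longlongrightarrow> (- fst a, - snd a)) (nhds a)"
    by (intro tendsto_Pair tendsto_minus tendsto_fst tendsto_snd f)
  then show "(uminus \<longlongrightarrow> - a) (nhds a)"
    by (simp add: uminus_prod_def [abs_def])
qed

instance prod :: (topological_ab_group_add, topological_ab_group_add) topological_ab_group_add ..

instance prod :: (topological_real_vector, topological_real_vector) topological_real_vector
proof
  fix a :: real and b :: "'a \<times> 'b"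
  have f: "(fst \<longlongrightarrow> a) (nhds a \<times>\<^sub>F nhds b)" "(snd \<longlongrightarrow> b) (nhds a \<times>\<^sub>F nhds b)"
    by (rule filterlim_fst, rule filterlim_snd)
  have "((\<lambda>x. (fst x *\<^sub>R fst (snd x), fst x *\<^sub>R snd (snd x)))
          \<longlongrightarrow> (a *\<^sub>R fst b, a *\<^sub>R snd b)) (nhds a \<times>\<^sub>F nhds b)"
    by (intro tendsto_Pair tendsto_scaleR_tvs tendsto_fst tendsto_snd f)
  then show "LIM x (nhds a \<times>\<^sub>F nhds b). fst x *\<^sub>R snd x :> nhds (a *\<^sub>R b)"
    by (simp add: scaleR_prod_def)
qed

definition has_dir_deriv ::
  "('a::topological_real_vector \<Rightarrow> 'b::topological_real_vector) \<Rightarrow> 'a \<Rightarrow> 'a \<Rightarrow> 'b \<Rightarrow> bool"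
  where "has_dir_deriv h u v l \<longleftrightarrow>
    ((\<lambda>t::real. (1 / t) *\<^sub>R (h (u + t *\<^sub>R v) - h u)) \<longlongrightarrow> l) (at 0)"

definition dir_deriv ::
  "('a::topological_real_vector \<Rightarrow> 'b::topological_real_vector) \<Rightarrow> 'a \<Rightarrow> 'a \<Rightarrow> 'b"
  where "dir_deriv h u v = (THE l. has_dir_deriv h u v l)"

text \<open>
  Maps defined on an open set \<open>O'\<close> are total functions with irrelevant values outside \<open>O'\<close>;
  since \<open>O'\<close> is open, directional derivatives at points of \<open>O'\<close> do not depend on these values.
\<close>

definition C1_MB ::
  "'a::topological_real_vector set \<Rightarrow> ('a \<Rightarrow> 'b::topological_real_vector) \<Rightarrow> bool"
  where "C1_MB O' h \<longleftrightarrow>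
    open O' \<and> continuous_on O' h \<and>
    (\<forall>u\<in>O'. \<forall>v. \<exists>l. has_dir_deriv h u v l) \<and>
    continuous_on (O' \<times> UNIV) (\<lambda>(u, v). dir_deriv h u v)"

definition tvs_bounded :: "'a::topological_real_vector set \<Rightarrow> bool"
  where "tvs_bounded B \<longleftrightarrow>
    (\<forall>N. open N \<and> 0 \<in> N \<longrightarrow> (\<exists>r>0. \<forall>t\<ge>r. B \<subseteq> (\<lambda>x. t *\<^sub>R x) ` N))"

definition continuous_linear_maps ::
  "('a::topological_real_vector \<Rightarrow> 'b::topological_real_vector) set"
  where "continuous_linear_maps = {A. linear A \<and> continuous_on UNIV A}"

text \<open>
  The topology of uniform convergence on bounded sets: the sets
  \<open>{T. (T - A) B \<subseteq> N}\<close>, with \<open>B\<close> bounded and \<open>N\<close> a neighbourhood of \<open>0\<close>, form a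
  neighbourhood base at \<open>A\<close>.
\<close>

definition Lc_open ::
  "('a::topological_real_vector \<Rightarrow> 'b::topological_real_vector) set \<Rightarrow> bool"
  where "Lc_open S \<longleftrightarrow>
    S \<subseteq> continuous_linear_maps \<and>
    (\<forall>A\<in>S. \<exists>B N. tvs_bounded B \<and> open N \<and> 0 \<in> N \<and>
      {T \<in> continuous_linear_maps. \<forall>x\<in>B. T x - A x \<in> N} \<subseteq> S)"

definition Lc_topology ::
  "('a::topological_real_vector \<Rightarrow> 'b::topological_real_vector) topology"
  where "Lc_topology = topology Lc_open"

lemma tvs_bounded_empty: "tvs_bounded {}"
  unfolding tvs_bounded_def by (auto intro: exI[of _ 1])

lemma tvs_bounded_Un:
  assumes "tvs_bounded A" "tvs_bounded B"
  shows "tvs_bounded (A \<union> B)"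
  unfolding tvs_bounded_def
proof (intro allI impI)
  fix N :: "'a set"
  assume N: "open N \<and> 0 \<in> N"
  obtain r1 where "r1 > 0" "\<forall>t\<ge>r1. A \<subseteq> (\<lambda>x. t *\<^sub>R x) ` N"
    using assms(1) N unfolding tvs_bounded_def by blast
  moreover obtain r2 where "r2 > 0" "\<forall>t\<ge>r2. B \<subseteq> (\<lambda>x. t *\<^sub>R x) ` N"
    using assms(2) N unfolding tvs_bounded_def by blast
  ultimately show "\<exists>r>0. \<forall>t\<ge>r. A \<union> B \<subseteq> (\<lambda>x. t *\<^sub>R x) ` N"
    by (intro exI[of _ "max r1 r2"]) auto
qed

lemma istopology_Lc_open: "istopology Lc_open"
  unfolding istopology_def
proof (intro conjI allI impI)
  fix S T :: "('a \<Rightarrow> 'b) set"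
  assume S: "Lc_open S" and T: "Lc_open T"
  show "Lc_open (S \<inter> T)"
    unfolding Lc_open_def
  proof (intro conjI ballI)
    show "S \<inter> T \<subseteq> continuous_linear_maps"
      using S unfolding Lc_open_def by blast
    fix A assume A: "A \<in> S \<inter> T"
    obtain B N where 1: "tvs_bounded B" "open N" "0 \<in> N"
      "{T' \<in> continuous_linear_maps. \<forall>x\<in>B. T' x - A x \<in> N} \<subseteq> S"
      using S A unfolding Lc_open_def by blast
    obtain B' N' where 2: "tvs_bounded B'" "open N'" "0 \<in> N'"
      "{T' \<in> continuous_linear_maps. \<forall>x\<in>B'. T' x - A x \<in> N'} \<subseteq> T"
      using T A unfolding Lc_open_def by blast
    show "\<exists>B N. tvs_bounded B \<and> open N \<and> 0 \<in> N \<and>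
      {T' \<in> continuous_linear_maps. \<forall>x\<in>B. T' x - A x \<in> N} \<subseteq> S \<inter> T"
    proof (intro exI conjI)
      show "tvs_bounded (B \<union> B')" "open (N \<inter> N')" "0 \<in> N \<inter> N'"
        using 1 2 by (auto intro: tvs_bounded_Un)
      show "{T' \<in> continuous_linear_maps. \<forall>x\<in>B \<union> B'. T' x - A x \<in> N \<inter> N'} \<subseteq> S \<inter> T"
        using 1(4) 2(4) by blast
    qed
  qed
next
  fix K :: "('a \<Rightarrow> 'b) set set"
  assume "\<forall>S\<in>K. Lc_open S"
  then show "Lc_open (\<Union>K)"
    unfolding Lc_open_def by (meson Sup_le_iff UnionE Union_upper order_trans)
qed

lemma openin_Lc_topology: "openin Lc_topology S \<longleftrightarrow> Lc_open S"
  by (simp add: Lc_topology_def istopology_Lc_open)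

lemma topspace_Lc_topology: "topspace Lc_topology = continuous_linear_maps"
proof -
  have "Lc_open (continuous_linear_maps :: ('a \<Rightarrow> 'b) set)"
    unfolding Lc_open_def
    by (intro conjI ballI exI[of _ "{}"] exI[of _ UNIV]) (auto simp: tvs_bounded_empty)
  then show ?thesis
    unfolding topspace_def openin_Lc_topology by (auto simp: Lc_open_def)
qed

definition C1_F ::
  "'a::topological_real_vector set \<Rightarrow> ('a \<Rightarrow> 'b::topological_real_vector) \<Rightarrow> bool"
  where "C1_F O' h \<longleftrightarrow>
    open O' \<and> continuous_on O' h \<and>
    (\<forall>u\<in>O'. \<forall>v. \<exists>l. has_dir_deriv h u v l) \<and>
    (\<forall>u\<in>O'. dir_deriv h u \<in> continuous_linear_maps) \<and>
    continuous_map (top_of_set O') Lc_topology (dir_deriv h)"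


section \<open>The spaces of continuous maps on the nonpositive half-line\<close>

text \<open>
  \<open>C\<^sub>m\<close> is \<open>(real ^ 'm) hist\<close>, \<open>C\<^sub>1\<close> is \<open>real hist\<close> and \<open>C\<^sub>n\<^sub>+\<^sub>1\<close> is
  \<open>(real \<times> (real ^ 'n)) hist\<close>.  A map on \<open>{..0}\<close> is represented by its extension by \<open>0\<close>.
\<close>

typedef (overloaded) ('a::real_normed_vector) hist =
  "{f :: real \<Rightarrow> 'a. continuous_on {..0} f \<and> (\<forall>s>0. f s = 0)}"
  morphisms happ Abs_hist
  by (rule exI[of _ "\<lambda>_. 0"]) auto

definition to_hist :: "(real \<Rightarrow> 'a::real_normed_vector) \<Rightarrow> 'a hist"
  where "to_hist f = Abs_hist (\<lambda>s. if s \<le> 0 then f s else 0)"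

lemma continuous_on_happ: "continuous_on {..0} (happ \<phi>)"
  using happ[of \<phi>] by simp

lemma happ_pos: "s > 0 \<Longrightarrow> happ \<phi> s = 0"
  using happ[of \<phi>] by simp

lemma happ_to_hist:
  assumes "continuous_on {..0} f"
  shows "happ (to_hist f) s = (if s \<le> 0 then f s else 0)"
proof -
  have "continuous_on {..0} (\<lambda>s::real. if s \<le> 0 then f s else 0)"
    using assms by (rule continuous_on_eq) auto
  then show ?thesis
    unfolding to_hist_def by (subst Abs_hist_inverse) auto
qed

lemma hist_eqI:
  assumes "\<And>s. s \<le> 0 \<Longrightarrow> happ \<phi> s = happ \<xi> s"
  shows "\<phi> = \<xi>"
proof -
  have "happ \<phi> = happ \<xi>"
    using assms by (metis ext happ_pos not_le)
  then show ?thesis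
    by (simp add: happ_inject)
qed

instantiation hist :: (real_normed_vector) real_vector
begin

definition "0 = to_hist (\<lambda>_. 0)"
definition "\<phi> + \<xi> = to_hist (\<lambda>s. happ \<phi> s + happ \<xi> s)"
definition "\<phi> - \<xi> = to_hist (\<lambda>s. happ \<phi> s - happ \<xi> s)"
definition "- \<phi> = to_hist (\<lambda>s. - happ \<phi> s)"
definition "c *\<^sub>R \<phi> = to_hist (\<lambda>s. c *\<^sub>R happ \<phi> s)"

lemma happ_zero [simp]: "happ 0 s = 0"
  and happ_add [simp]: "happ (\<phi> + \<xi>) s = happ \<phi> s + happ \<xi> s"
  and happ_diff [simp]: "happ (\<phi> - \<xi>) s = happ \<phi> s - happ \<xi> s"
  and happ_minus [simp]: "happ (- \<phi>) s = - happ \<phi> s"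
  and happ_scaleR [simp]: "happ (c *\<^sub>R \<phi>) s = c *\<^sub>R happ \<phi> s"
  for \<phi> \<xi> :: "'a hist"
  unfolding zero_hist_def plus_hist_def minus_hist_def uminus_hist_def scaleR_hist_def
  by (subst happ_to_hist; auto intro!: continuous_intros continuous_on_happ simp: happ_pos)+

instance
  by standard (rule hist_eqI; simp add: algebra_simps)+

end

instantiation hist :: (real_normed_vector) topological_space
begin

text \<open>Locally uniform convergence: basic neighbourhoods are uniform on \<open>[-k, 0]\<close>.\<close>

definition open_hist :: "'a hist set \<Rightarrow> bool"
  where "open_hist S \<longleftrightarrow>
    (\<forall>\<phi>\<in>S. \<exists>k. \<exists>e>0. {\<xi>. \<forall>s\<in>{-k..0}. dist (happ \<xi> s) (happ \<phi> s) < e} \<subseteq> S)"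

instance
proof
  show "open (UNIV :: 'a hist set)"
    unfolding open_hist_def by (auto intro: exI[of _ 1])
next
  fix S T :: "'a hist set"
  assume S: "open S" and T: "open T"
  show "open (S \<inter> T)"
    unfolding open_hist_def
  proof
    fix \<phi> assume \<phi>: "\<phi> \<in> S \<inter> T"
    obtain k e where 1: "e > 0" "{\<xi>. \<forall>s\<in>{-k..0}. dist (happ \<xi> s) (happ \<phi> s) < e} \<subseteq> S"
      using S \<phi> unfolding open_hist_def by blast
    obtain l d where 2: "d > 0" "{\<xi>. \<forall>s\<in>{-l..0}. dist (happ \<xi> s) (happ \<phi> s) < d} \<subseteq> T"
      using T \<phi> unfolding open_hist_def by blast
    have "{\<xi>. \<forall>s\<in>{-max k l..0}. dist (happ \<xi> s) (happ \<phi> s) < min e d} \<subseteq> S \<inter> T"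
    proof
      fix \<xi> assume "\<xi> \<in> {\<xi>. \<forall>s\<in>{-max k l..0}. dist (happ \<xi> s) (happ \<phi> s) < min e d}"
      then have *: "dist (happ \<xi> s) (happ \<phi> s) < min e d" if "s \<in> {-max k l..0}" for s
        using that by blast
      have "\<forall>s\<in>{-k..0}. dist (happ \<xi> s) (happ \<phi> s) < e"
        using * by auto
      moreover have "\<forall>s\<in>{-l..0}. dist (happ \<xi> s) (happ \<phi> s) < d"
        using * by auto
      ultimately show "\<xi> \<in> S \<inter> T"
        using 1(2) 2(2) by blast
    qed
    moreover have "min e d > 0"
      using 1(1) 2(1) by simp
    ultimately show
      "\<exists>k. \<exists>e>0. {\<xi>. \<forall>s\<in>{-k..0}. dist (happ \<xi> s) (happ \<phi> s) < e} \<subseteq> S \<inter> T"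
      by blast
  qed
next
  fix K :: "'a hist set set"
  assume K: "\<forall>S\<in>K. open S"
  show "open (\<Union>K)"
    unfolding open_hist_def
  proof
    fix \<phi> assume "\<phi> \<in> \<Union>K"
    then obtain S where "S \<in> K" "\<phi> \<in> S" by blast
    with K obtain k e where
      "e > 0" "{\<xi>. \<forall>s\<in>{-k..0}. dist (happ \<xi> s) (happ \<phi> s) < e} \<subseteq> S"
      unfolding open_hist_def by blast
    with \<open>S \<in> K\<close> show
      "\<exists>k. \<exists>e>0. {\<xi>. \<forall>s\<in>{-k..0}. dist (happ \<xi> s) (happ \<phi> s) < e} \<subseteq> \<Union>K"
      by blast
  qed
qed

end

lemma open_hist_basic:
  assumes "e > 0"
  shows "open {\<xi>. \<exists>d<e. \<forall>s\<in>{-k..0}. dist (happ \<xi> s) (happ \<phi> s) \<le> d}"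
  unfolding open_hist_def
proof
  fix \<xi> assume "\<xi> \<in> {\<xi>. \<exists>d<e. \<forall>s\<in>{-k..0}. dist (happ \<xi> s) (happ \<phi> s) \<le> d}"
  then obtain d where d: "d < e" "\<And>s. s \<in> {-k..0} \<Longrightarrow> dist (happ \<xi> s) (happ \<phi> s) \<le> d"
    by auto
  have "{\<psi>. \<forall>s\<in>{-k..0}. dist (happ \<psi> s) (happ \<xi> s) < (e - d) / 2}
    \<subseteq> {\<xi>. \<exists>d<e. \<forall>s\<in>{-k..0}. dist (happ \<xi> s) (happ \<phi> s) \<le> d}"
  proof
    fix \<psi> assume "\<psi> \<in> {\<psi>. \<forall>s\<in>{-k..0}. dist (happ \<psi> s) (happ \<xi> s) < (e - d) / 2}"
    then have "dist (happ \<psi> s) (happ \<phi> s) \<le> (e + d) / 2" if "s \<in> {-k..0}" for s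
      using d(2)[OF that] that dist_triangle[of "happ \<psi> s" "happ \<phi> s" "happ \<xi> s"]
      by (fastforce simp: field_simps)
    moreover have "(e + d) / 2 < e"
      using d(1) by simp
    ultimately show "\<psi> \<in> {\<xi>. \<exists>d<e. \<forall>s\<in>{-k..0}. dist (happ \<xi> s) (happ \<phi> s) \<le> d}"
      by blast
  qed
  then show "\<exists>k'. \<exists>e'>0. {\<psi>. \<forall>s\<in>{-k'..0}. dist (happ \<psi> s) (happ \<xi> s) < e'}
    \<subseteq> {\<xi>. \<exists>d<e. \<forall>s\<in>{-k..0}. dist (happ \<xi> s) (happ \<phi> s) \<le> d}"
    using d(1) by (intro exI[of _ k] exI[of _ "(e - d) / 2"]) simp
qed

lemma tendsto_hist_iff:
  fixes \<phi> :: "'a::real_normed_vector hist"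
  shows "(f \<longlongrightarrow> \<phi>) F \<longleftrightarrow> (\<forall>k. uniform_limit {-k..0} (\<lambda>x. happ (f x)) (happ \<phi>) F)"
proof
  assume L: "(f \<longlongrightarrow> \<phi>) F"
  show "\<forall>k. uniform_limit {-k..0} (\<lambda>x. happ (f x)) (happ \<phi>) F"
  proof (intro allI uniform_limitI)
    fix k e :: real assume "e > 0"
    from topological_tendstoD[OF L open_hist_basic[OF this, of k \<phi>]] \<open>e > 0\<close>
    have "\<forall>\<^sub>F x in F. \<exists>d<e. \<forall>s\<in>{-k..0}. dist (happ (f x) s) (happ \<phi> s) \<le> d"
      by (auto intro: exI[of _ 0])
    then show "\<forall>\<^sub>F x in F. \<forall>s\<in>{-k..0}. dist (happ (f x) s) (happ \<phi> s) < e"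
      by (rule eventually_mono) (meson le_less_trans)
  qed
next
  assume U: "\<forall>k. uniform_limit {-k..0} (\<lambda>x. happ (f x)) (happ \<phi>) F"
  show "(f \<longlongrightarrow> \<phi>) F"
  proof (rule topological_tendstoI)
    fix S assume "open S" "\<phi> \<in> S"
    then obtain k e where
      *: "e > 0" "{\<xi>. \<forall>s\<in>{-k..0}. dist (happ \<xi> s) (happ \<phi> s) < e} \<subseteq> S"
      unfolding open_hist_def by blast
    have "\<forall>\<^sub>F x in F. \<forall>s\<in>{-k..0}. dist (happ (f x) s) (happ \<phi> s) < e"
      by (rule uniform_limitD[OF U[rule_format] *(1)])
    then show "\<forall>\<^sub>F x in F. f x \<in> S"
      by (rule eventually_mono) (use *(2) in blast)
  qed
qed

instance hist :: (real_normed_vector) topological_real_vector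
proof
  fix \<phi> \<xi> :: "'a hist"
  assume "\<phi> \<noteq> \<xi>"
  then obtain s where s: "s \<le> 0" "happ \<phi> s \<noteq> happ \<xi> s"
    using hist_eqI by blast
  define e where "e = dist (happ \<phi> s) (happ \<xi> s) / 2"
  have e: "e > 0" using s by (simp add: e_def)
  define N where "N \<psi> = {\<xi>. \<exists>d<e. \<forall>r\<in>{-(-s)..0}. dist (happ \<xi> r) (happ \<psi> r) \<le> d}"
    for \<psi> :: "'a hist"
  have "open (N \<phi>)" "open (N \<xi>)"
    unfolding N_def using e by (auto intro: open_hist_basic simp del: minus_minus)
  moreover have "\<phi> \<in> N \<phi>" "\<xi> \<in> N \<xi>"
    using e by (auto simp: N_def intro: exI[of _ 0])
  moreover have "N \<phi> \<inter> N \<xi> = {}"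
  proof (rule ccontr)
    assume "N \<phi> \<inter> N \<xi> \<noteq> {}"
    then obtain \<psi> where "\<psi> \<in> N \<phi>" "\<psi> \<in> N \<xi>" by blast
    then have "dist (happ \<psi> s) (happ \<phi> s) < e" "dist (happ \<psi> s) (happ \<xi> s) < e"
      using s(1) by (auto simp: N_def intro: le_less_trans)
    then show False
      using dist_triangle3[of "happ \<phi> s" "happ \<xi> s" "happ \<psi> s"] by (simp add: e_def)
  qed
  ultimately show "\<exists>U V. open U \<and> open V \<and> \<phi> \<in> U \<and> \<xi> \<in> V \<and> U \<inter> V = {}"
    by blast
next
  fix \<phi> \<xi> :: "'a hist"
  have f: "(fst \<longlongrightarrow> \<phi>) (nhds \<phi> \<times>\<^sub>F nhds \<xi>)" "(snd \<longlongrightarrow> \<xi>) (nhds \<phi> \<times>\<^sub>F nhds \<xi>)"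
    by (rule filterlim_fst, rule filterlim_snd)
  show "LIM x (nhds \<phi> \<times>\<^sub>F nhds \<xi>). fst x + snd x :> nhds (\<phi> + \<xi>)"
    using f unfolding tendsto_hist_iff happ_add by (auto intro: uniform_limit_intros)
next
  fix \<phi> :: "'a hist"
  have "((\<lambda>x. x) \<longlongrightarrow> \<phi>) (nhds \<phi>)"
    by (rule filterlim_ident)
  then show "(uminus \<longlongrightarrow> - \<phi>) (nhds \<phi>)"
    unfolding tendsto_hist_iff happ_minus by (auto intro: uniform_limit_intros)
next
  fix a :: real and \<phi> :: "'a hist"
  have f: "(fst \<longlongrightarrow> a) (nhds a \<times>\<^sub>F nhds \<phi>)" "(snd \<longlongrightarrow> \<phi>) (nhds a \<times>\<^sub>F nhds \<phi>)"
    by (rule filterlim_fst, rule filterlim_snd)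
  show "LIM x (nhds a \<times>\<^sub>F nhds \<phi>). fst x *\<^sub>R snd x :> nhds (a *\<^sub>R \<phi>)"
    unfolding tendsto_hist_iff happ_scaleR
  proof
    fix k :: real
    have u1: "uniform_limit {-k..0} (\<lambda>x _. fst x) (\<lambda>_. a) (nhds a \<times>\<^sub>F nhds \<phi>)"
      using f(1) by (auto simp: uniform_limit_iff dest: tendstoD)
    have u2: "uniform_limit {-k..0} (\<lambda>x. happ (snd x)) (happ \<phi>) (nhds a \<times>\<^sub>F nhds \<phi>)"
      using f(2) unfolding tendsto_hist_iff by blast
    have "continuous_on {-k..0} (happ \<phi>)"
      by (rule continuous_on_subset[OF continuous_on_happ]) auto
    then have "bounded (happ \<phi> ` {-k..0})"
      by (intro compact_imp_bounded compact_continuous_image) auto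
    then show "uniform_limit {-k..0} (\<lambda>x s. fst x *\<^sub>R happ (snd x) s)
        (\<lambda>s. a *\<^sub>R happ \<phi> s) (nhds a \<times>\<^sub>F nhds \<phi>)"
      by (intro bounded_bilinear.bounded_uniform_limit[OF bounded_bilinear_scaleR] u1 u2)
        (auto simp: image_constant_conv)
  qed
qed

definition hist_fst :: "('a::real_normed_vector \<times> 'b::real_normed_vector) hist \<Rightarrow> 'a hist"
  where "hist_fst \<psi> = to_hist (\<lambda>s. fst (happ \<psi> s))"

definition hist_snd :: "('a::real_normed_vector \<times> 'b::real_normed_vector) hist \<Rightarrow> 'b hist"
  where "hist_snd \<psi> = to_hist (\<lambda>s. snd (happ \<psi> s))"

definition hist_pair ::
  "'a::real_normed_vector hist \<Rightarrow> 'b::real_normed_vector hist \<Rightarrow> ('a \<times> 'b) hist"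
  where "hist_pair \<phi> \<xi> = to_hist (\<lambda>s. (happ \<phi> s, happ \<xi> s))"

definition time_hist :: "real \<Rightarrow> real hist"
  where "time_hist t = to_hist (\<lambda>u. t + u)"


section \<open>Solutions of autonomous delay equations\<close>

definition segment :: "(real \<Rightarrow> 'a::real_normed_vector) \<Rightarrow> real \<Rightarrow> 'a hist"
  where "segment y t = to_hist (\<lambda>s. y (t + s))"

definition delay_solution ::
  "'a::real_normed_vector hist set \<Rightarrow> ('a hist \<Rightarrow> 'a) \<Rightarrow> real set \<Rightarrow> (real \<Rightarrow> 'a) \<Rightarrow> bool"
  where "delay_solution U f I y \<longleftrightarrow>
    is_interval I \<and>
    continuous_on {s + t | s t. s \<le> 0 \<and> t \<in> I} y \<and>
    (\<forall>t\<in>I. segment y t \<in> U \<and> (y has_vector_derivative f (segment y t)) (at t within I))"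

text \<open>Maximality is with respect to extension to any larger interval in \<open>[0, \<infinity>)\<close>.\<close>

definition maximal_solution ::
  "'a::real_normed_vector hist set \<Rightarrow> ('a hist \<Rightarrow> 'a) \<Rightarrow> 'a hist \<Rightarrow> ereal \<Rightarrow> (real \<Rightarrow> 'a) \<Rightarrow> bool"
  where "maximal_solution U f \<psi> T y \<longleftrightarrow>
    0 < T \<and>
    delay_solution U f {t. 0 \<le> t \<and> ereal t < T} y \<and>
    segment y 0 = \<psi> \<and>
    (\<forall>J z. {t. 0 \<le> t \<and> ereal t < T} \<subseteq> J \<and> J \<subseteq> {0..} \<and>
       delay_solution U f J z \<and> (\<forall>s. ereal s < T \<longrightarrow> z s = y s)
       \<longrightarrow> J = {t. 0 \<le> t \<and> ereal t < T})"

definition exit_time ::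
  "'a::real_normed_vector hist set \<Rightarrow> ('a hist \<Rightarrow> 'a) \<Rightarrow> 'a hist \<Rightarrow> ereal"
  where "exit_time U f \<psi> = (THE T. \<exists>y. maximal_solution U f \<psi> T y)"

text \<open>
  The choice below only fixes the irrelevant values at times \<open>t \<ge> exit_time U f \<psi>\<close>.
\<close>

definition max_solution ::
  "'a::real_normed_vector hist set \<Rightarrow> ('a hist \<Rightarrow> 'a) \<Rightarrow> 'a hist \<Rightarrow> real \<Rightarrow> 'a"
  where "max_solution U f \<psi> = (SOME y. maximal_solution U f \<psi> (exit_time U f \<psi>) y)"

definition semiflow_domain ::
  "'a::real_normed_vector hist set \<Rightarrow> ('a hist \<Rightarrow> 'a) \<Rightarrow> (real \<times> 'a hist) set"
  where "semiflow_domain U f = {(t, \<psi>). 0 \<le> t \<and> \<psi> \<in> U \<and> ereal t < exit_time U f \<psi>}"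

definition semiflow ::
  "'a::real_normed_vector hist set \<Rightarrow> ('a hist \<Rightarrow> 'a) \<Rightarrow> real \<times> 'a hist \<Rightarrow> 'a hist"
  where "semiflow U f = (\<lambda>(t, \<psi>). segment (max_solution U f \<psi>) t)"


section \<open>The process of a nonautonomous delay equation\<close>

definition U_g :: "(real \<times> (real ^ 'n) hist) set \<Rightarrow> (real \<times> (real ^ 'n)) hist set"
  where "U_g V = {\<psi>. (happ (hist_fst \<psi>) 0, hist_snd \<psi>) \<in> V}"

definition f_g ::
  "(real \<times> (real ^ 'n) hist \<Rightarrow> real ^ 'n) \<Rightarrow> (real \<times> (real ^ 'n)) hist \<Rightarrow> real \<times> (real ^ 'n)"
  where "f_g g \<psi> = (1, g (happ (hist_fst \<psi>) 0, hist_snd \<psi>))"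

definition \<Omega>_g ::
  "(real \<times> (real ^ 'n) hist) set \<Rightarrow> (real \<times> (real ^ 'n) hist \<Rightarrow> real ^ 'n)
    \<Rightarrow> (real \<times> (real \<times> (real ^ 'n)) hist) set"
  where "\<Omega>_g V g = semiflow_domain (U_g V) (f_g g)"

definition \<Sigma>_g ::
  "(real \<times> (real ^ 'n) hist) set \<Rightarrow> (real \<times> (real ^ 'n) hist \<Rightarrow> real ^ 'n)
    \<Rightarrow> real \<times> (real \<times> (real ^ 'n)) hist \<Rightarrow> (real \<times> (real ^ 'n)) hist"
  where "\<Sigma>_g V g = semiflow (U_g V) (f_g g)"

definition process_dom ::
  "(real \<times> (real ^ 'n) hist) set \<Rightarrow> (real \<times> (real ^ 'n) hist \<Rightarrow> real ^ 'n)
    \<Rightarrow> (real \<times> real \<times> (real ^ 'n) hist) set"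
  where "process_dom V g =
    {(t, t\<^sub>0, \<phi>). t\<^sub>0 \<le> t \<and> (t - t\<^sub>0, hist_pair (time_hist t\<^sub>0) \<phi>) \<in> \<Omega>_g V g}"

definition process ::
  "(real \<times> (real ^ 'n) hist) set \<Rightarrow> (real \<times> (real ^ 'n) hist \<Rightarrow> real ^ 'n)
    \<Rightarrow> real \<times> real \<times> (real ^ 'n) hist \<Rightarrow> (real ^ 'n) hist"
  where "process V g =
    (\<lambda>(t, t\<^sub>0, \<phi>). hist_snd (\<Sigma>_g V g (t - t\<^sub>0, hist_pair (time_hist t\<^sub>0) \<phi>)))"

end

(*
  Both notions of smoothness make Dg locally bounded: |Dg(w)v| <= 1 for w near u and v near 0. Since
  Dg(w) is homogeneous, the mean value theorem along segments turns this into a Lipschitz estimate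
  near u for one of the seminorms "supremum over [-k, 0]", and f_g inherits it. For such right hand
  sides a contraction argument gives local solutions, which are unique, and solutions can be
  concatenated; hence the maximal solutions form a semiflow. The first component of a solution
  starting at a time history is again the time, so that
  Sigma_g(t - t0, (t0*, phi)) = (t*, P(t, t0, phi)), and the semiflow property becomes that of P.
*)
theory Submission
  imports Defs
begin

text \<open>The history spaces carry no norm, only the suprema over \<open>{-k..0}\<close>, so each
  local estimate comes with its own \<open>k\<close>. This shapes two places. Under
  \<open>C1_MB\<close> the bound on the derivative follows from joint continuity at
  \<open>(u, 0)\<close>. Under \<open>C1_F\<close> the topology controls derivatives only on bounded
  sets, and no neighbourhood of 0 in these spaces is bounded. So no bounded set fixed in advance
  yields the bound; a null sequence of directions, whose range is bounded, replaces it. Nor can one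
  contract in the history space itself: the iteration runs in the Banach space of bounded continuous
  functions, whose members are added to the initial history frozen at its value at 0. As
  \<open>exit_time\<close> and \<open>max_solution\<close> are given by \<open>THE\<close> and
  \<open>SOME\<close>, uniqueness of the maximal interval must precede any statement on the
  semiflow; after that, solutions on compact intervals \<open>{0..b}\<close> suffice.\<close>

section \<open>Derivatives on intervals and basic neighbourhoods of histories\<close>

lemma has_vector_derivative_bound:
  fixes f :: "real \<Rightarrow> 'a::real_normed_vector"
  assumes "convex S" and "\<And>t. t \<in> S \<Longrightarrow> (f has_vector_derivative f' t) (at t within S)"
    and "\<And>t. t \<in> S \<Longrightarrow> norm (f' t) \<le> B" and "x \<in> S" "y \<in> S"
  shows "norm (f x - f y) \<le> B * \<bar>x - y\<bar>"
proof -
  have "onorm (\<lambda>h. h *\<^sub>R f' t) \<le> B" if "t \<in> S" for t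
    by (rule onorm_le)
      (use mult_right_mono[OF assms(3)[OF that] abs_ge_zero] in \<open>simp add: mult.commute\<close>)
  from differentiable_bound[OF assms(1) assms(2)[unfolded has_vector_derivative_def] this assms(4,5)]
  show ?thesis by simp
qed

text \<open>Off the closure of a set the filter \<open>at t within\<close> is trivial, so a
  derivative has to be checked on the closure only. This glues one-sided derivatives at the time
  where two solutions meet.\<close>

lemma has_vector_derivative_Un:
  assumes "t \<in> closure A \<Longrightarrow> (f has_vector_derivative D) (at t within A)"
    and "t \<in> closure B \<Longrightarrow> (f has_vector_derivative D) (at t within B)"
  shows "(f has_vector_derivative D) (at t within A \<union> B)"
proof -
  have "(f has_vector_derivative D) (at t within C)"
    if "t \<in> closure C \<Longrightarrow> (f has_vector_derivative D) (at t within C)" for C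
  proof (cases "t \<in> closure C")
    case False
    then have "at t within C = bot"
      using not_in_closure_trivial_limitI trivial_limit_def by blast
    then show ?thesis
      by (simp add: has_vector_derivative_def has_derivative_def bounded_linear_scaleR_left)
  qed (use that in blast)
  then have "(f has_vector_derivative D) (at t within A)" "(f has_vector_derivative D) (at t within B)"
    using assms by blast+
  then show ?thesis
    by (simp add: has_vector_derivative_def has_derivative_within Lim_within_Un)
qed

text \<open>The basic neighbourhoods of \<open>open_hist_def\<close>. A negative \<open>k\<close>
  makes \<open>{-k..0}\<close> empty and the ball the whole space, so \<open>0 \<le> k\<close> is
  recorded wherever the value at 0 must be controlled.\<close>

definition hist_ball :: "real \<Rightarrow> real \<Rightarrow> 'a::real_normed_vector hist \<Rightarrow> 'a hist set"
  where "hist_ball k e \<phi> = {\<xi>. \<forall>s\<in>{-k..0}. dist (happ \<xi> s) (happ \<phi> s) < e}"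

lemma hist_ballD: "\<xi> \<in> hist_ball k e \<phi> \<Longrightarrow> -k \<le> s \<Longrightarrow> s \<le> 0 \<Longrightarrow> dist (happ \<xi> s) (happ \<phi> s) < e"
  by (auto simp: hist_ball_def)

lemma hist_ball_self: "e > 0 \<Longrightarrow> \<phi> \<in> hist_ball k e \<phi>"
  by (simp add: hist_ball_def)

lemma hist_ball_mono: "k' \<le> k \<Longrightarrow> e \<le> e' \<Longrightarrow> hist_ball k e \<phi> \<subseteq> hist_ball k' e' \<phi>"
  unfolding hist_ball_def by (force intro: less_le_trans)

subsection \<open>Segments\<close>

lemma happ_segment:
  assumes "continuous_on {..b} y" "t \<le> b" "s \<le> 0"
  shows "happ (segment y t) s = y (t + s)"
proof -
  have "continuous_on {..0} (\<lambda>s. y (t + s))"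
    by (rule continuous_on_compose2[OF assms(1)]) (use assms(2) in \<open>auto intro!: continuous_intros\<close>)
  then show ?thesis
    using assms(3) by (simp add: segment_def happ_to_hist)
qed

lemma segment_cong:
  assumes "\<And>s. s \<le> t \<Longrightarrow> y s = z s"
  shows "segment y t = segment z t"
  unfolding segment_def to_hist_def using assms
  by (intro arg_cong[of _ _ Abs_hist]) (auto simp: fun_eq_iff)

lemma segment_shift: "segment (\<lambda>t. z (t - a)) t = segment z (t - a)"
  unfolding segment_def by (simp add: algebra_simps)

lemma segment_near:
  assumes y: "continuous_on {..b} y" and "c \<le> b" "e > 0" "k \<ge> 0"
  shows "\<exists>\<delta>>0. \<forall>t. \<bar>t - c\<bar> < \<delta> \<and> t \<le> b \<longrightarrow> segment y t \<in> hist_ball k e (segment y c)"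
proof -
  \<comment> \<open>The interval contains \<open>t + s\<close> and \<open>c + s\<close> for all
    \<open>s\<close> in \<open>{-k..0}\<close> as soon as \<open>t\<close> is within 1 of
    \<open>c\<close>; hence the cap at 1 in the witness below.\<close>
  have "uniformly_continuous_on {c - 1 - k..b} y"
    by (rule compact_uniformly_continuous[OF continuous_on_subset[OF y]]) auto
  then obtain d where d: "d > 0"
    "\<And>r s. r \<in> {c - 1 - k..b} \<Longrightarrow> s \<in> {c - 1 - k..b} \<Longrightarrow> dist r s < d \<Longrightarrow> dist (y r) (y s) < e"
    using \<open>e > 0\<close> unfolding uniformly_continuous_on_def by metis
  show ?thesis
  proof (intro exI[of _ "min d 1"] conjI allI impI)
    fix t assume t: "\<bar>t - c\<bar> < min d 1 \<and> t \<le> b"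
    show "segment y t \<in> hist_ball k e (segment y c)"
      unfolding hist_ball_def
    proof safe
      fix s assume s: "s \<in> {-k..0}"
      have "dist (y (t + s)) (y (c + s)) < e"
        by (rule d(2)) (use s t \<open>c \<le> b\<close> \<open>k \<ge> 0\<close> in \<open>auto simp: dist_real_def\<close>)
      then show "dist (happ (segment y t) s) (happ (segment y c) s) < e"
        using s t \<open>c \<le> b\<close> by (simp add: happ_segment[OF y])
    qed
  qed (use d in auto)
qed

subsection \<open>Solutions\<close>

lemma history_atLeastAtMost:
  assumes "0 \<le> (b::real)"
  shows "{s + t | s t. s \<le> 0 \<and> t \<in> {0..b}} = {..b}"
proof safe
  fix x assume "x \<le> b"
  then show "\<exists>s t. x = s + t \<and> s \<le> 0 \<and> t \<in> {0..b}"
    using assms by (intro exI[of _ "x - b"] exI[of _ b]) auto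
qed auto

lemma history_less_ereal:
  assumes "0 < T"
  shows "{s + t | s t. s \<le> 0 \<and> t \<in> {t. 0 \<le> t \<and> ereal t < T}} = {t. ereal t < T}"
proof safe
  fix s t :: real assume "s \<le> 0" "ereal t < T"
  then show "ereal (s + t) < T" by (meson add_le_same_cancel2 ereal_less_eq(3) le_less_trans)
next
  fix x assume "ereal x < T"
  then show "\<exists>s t. x = s + t \<and> s \<le> 0 \<and> t \<in> {t. 0 \<le> t \<and> ereal t < T}"
    using assms by (intro exI[of _ "min x 0"] exI[of _ "max x 0"]) (auto simp: min_def max_def zero_ereal_def)
qed

lemma delay_solution_Icc:
  assumes "0 \<le> b"
  shows "delay_solution U f {0..b} y \<longleftrightarrow> continuous_on {..b} y \<and>
    (\<forall>t\<in>{0..b}. segment y t \<in> U \<and> (y has_vector_derivative f (segment y t)) (at t within {0..b}))"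
  unfolding delay_solution_def history_atLeastAtMost[OF assms] by (simp add: is_interval_cc)

lemma delay_solution_subset:
  assumes "delay_solution U f I y" "J \<subseteq> I" "is_interval J"
  shows "delay_solution U f J y"
  using assms(1) unfolding delay_solution_def
  by (intro conjI ballI continuous_on_subset[where t = "{s + t | s t. s \<le> 0 \<and> t \<in> J}"]
      has_vector_derivative_within_subset[OF _ assms(2)])
    (use assms(2,3) in \<open>auto\<close>)

lemma delay_solution_cong:
  assumes y: "delay_solution U f I y" and eq: "\<And>s t. t \<in> I \<Longrightarrow> s \<le> t \<Longrightarrow> z s = y s"
  shows "delay_solution U f I z"
proof -
  have seg: "segment z t = segment y t" if "t \<in> I" for t
    by (rule segment_cong) (use eq that in auto)
  have "continuous_on {s + t | s t. s \<le> 0 \<and> t \<in> I} z"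
  proof (rule continuous_on_eq)
    show "continuous_on {s + t | s t. s \<le> 0 \<and> t \<in> I} y"
      using y by (simp add: delay_solution_def)
    show "y x = z x" if "x \<in> {s + t | s t. s \<le> 0 \<and> t \<in> I}" for x
      using that eq by fastforce
  qed
  moreover have "(z has_vector_derivative f (segment z t)) (at t within I)" if "t \<in> I" for t
    unfolding seg[OF that]
    by (rule has_vector_derivative_transform[OF that, of _ y])
      (use eq y that in \<open>auto simp: delay_solution_def\<close>)
  ultimately show ?thesis
    using y by (simp add: delay_solution_def seg)
qed

text \<open>Concatenation needs no case distinction in its definition: \<open>z\<close> starts from
  the history \<open>segment y a\<close>, so the shifted \<open>z\<close> already reproduces
  \<open>y\<close> on \<open>{..a}\<close>. The equation is autonomous, hence invariant under the
  shift.\<close>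

lemma delay_solution_append:
  assumes y: "delay_solution U f {0..a} y" and z: "delay_solution U f {0..b} z"
    and ab: "0 \<le> a" "0 \<le> b" and seg: "segment z 0 = segment y a"
  shows "delay_solution U f {0..a + b} (\<lambda>t. z (t - a))" (is "delay_solution U f _ ?w")
    and "\<And>t. t \<le> a \<Longrightarrow> z (t - a) = y t"
proof -
  note Y = y[unfolded delay_solution_Icc[OF ab(1)]] and Z = z[unfolded delay_solution_Icc[OF ab(2)]]
  show eq: "z (t - a) = y t" if "t \<le> a" for t
    using happ_segment[of b z 0 "t - a"] happ_segment[of a y a "t - a"] Y Z ab that seg by simp
  have segw: "segment ?w t = segment y t" if "t \<le> a" for t
    by (rule segment_cong) (use eq that in auto)
  have "0 \<le> a + b" using ab by simp
  then show "delay_solution U f {0..a + b} ?w"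
    unfolding delay_solution_Icc[OF \<open>0 \<le> a + b\<close>]
  proof (intro conjI ballI)
    show "continuous_on {..a + b} ?w"
      by (rule continuous_on_compose2[of "{..b}" z])
        (use Z in \<open>auto intro!: continuous_intros\<close>)
    fix t assume t: "t \<in> {0..a + b}"
    show "segment ?w t \<in> U"
    proof (cases "t \<le> a")
      case True
      then show ?thesis using segw Y t by simp
    next
      case False
      then show ?thesis using Z t by (simp add: segment_shift)
    qed
    \<comment> \<open>Only \<open>t = a\<close> belongs to both pieces; there both one-sided
      derivatives are \<open>f\<close> of the common segment.\<close>
    have "(?w has_vector_derivative f (segment ?w t)) (at t within {0..a} \<union> {a..a + b})"
    proof (rule has_vector_derivative_Un)
      assume "t \<in> closure {0..a}"
      then have t': "t \<in> {0..a}" by simp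
      show "(?w has_vector_derivative f (segment ?w t)) (at t within {0..a})"
        by (rule has_vector_derivative_transform[OF t', of _ y])
          (use eq Y t' segw in auto)
    next
      assume "t \<in> closure {a..a + b}"
      then have t': "t - a \<in> {0..b}" by simp
      have 1: "((\<lambda>t. t - a) has_vector_derivative 1) (at t within {a..a + b})"
        by (auto intro!: derivative_eq_intros)
      have 2: "(\<lambda>t. t - a) ` {a..a + b} = {0..b}"
        by (auto simp: image_iff intro: bexI[of _ "_ + a"])
      have "(z \<circ> (\<lambda>t. t - a) has_vector_derivative 1 *\<^sub>R f (segment z (t - a))) (at t within {a..a + b})"
        by (rule vector_diff_chain_within[OF 1]) (use Z t' 2 in auto)
      then show "(?w has_vector_derivative f (segment ?w t)) (at t within {a..a + b})"
        by (simp add: segment_shift o_def)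
    qed
    moreover have "{0..a} \<union> {a..a + b} = {0..a + b}"
      using ab by auto
    ultimately show "(?w has_vector_derivative f (segment ?w t)) (at t within {0..a + b})"
      by simp
  qed
qed

subsection \<open>The semiflow of a locally Lipschitz right hand side\<close>

text \<open>Quantifying over all upper bounds \<open>M\<close> stands for the supremum of the
  distance over \<open>{-k..0}\<close>. Since \<open>0 \<le> k\<close>, the interval is nonempty and
  any such \<open>M\<close> is nonnegative.\<close>

locale locally_lipschitz_delay =
  fixes U :: "'a::banach hist set" and f :: "'a hist \<Rightarrow> 'a"
  assumes locally_lipschitz: "\<psi> \<in> U \<Longrightarrow> \<exists>k e L. 0 \<le> k \<and> 0 < e \<and> 0 \<le> L \<and> hist_ball k e \<psi> \<subseteq> U \<and>
    (\<forall>\<phi>\<in>hist_ball k e \<psi>. \<forall>\<xi>\<in>hist_ball k e \<psi>. \<forall>M.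
      (\<forall>s\<in>{-k..0}. dist (happ \<phi> s) (happ \<xi> s) \<le> M) \<longrightarrow> dist (f \<phi>) (f \<xi>) \<le> L * M)"
begin

text \<open>The Lipschitz estimate and \<open>segment_near\<close> use the same seminorm, so they
  compose. This makes the integrands of the later fixed point operator continuous.\<close>

lemma continuous_on_vector_field:
  assumes y: "continuous_on {..b} y" and U: "\<And>t. t \<in> I \<Longrightarrow> segment y t \<in> U" and I: "I \<subseteq> {..b}"
  shows "continuous_on I (\<lambda>t. f (segment y t))"
  unfolding continuous_on_iff
proof (intro ballI allI impI)
  fix c \<epsilon> :: real assume c: "c \<in> I" and "\<epsilon> > 0"
  obtain k e L where k: "0 \<le> k" "0 < e" "0 \<le> L"
    and L: "\<And>\<phi> \<xi> M. \<lbrakk>\<phi> \<in> hist_ball k e (segment y c); \<xi> \<in> hist_ball k e (segment y c);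
      \<And>s. s \<in> {-k..0} \<Longrightarrow> dist (happ \<phi> s) (happ \<xi> s) \<le> M\<rbrakk> \<Longrightarrow> dist (f \<phi>) (f \<xi>) \<le> L * M"
    using locally_lipschitz[OF U[OF c]] by metis
  \<comment> \<open>Dividing by \<open>L + 1\<close> instead of \<open>L\<close> covers
    \<open>L = 0\<close> and gives the strict inequality
    \<open>L * \<eta> < \<epsilon>\<close>.\<close>
  define \<eta> where "\<eta> = min e (\<epsilon> / (L + 1))"
  have \<eta>: "\<eta> > 0" "\<eta> \<le> e" "L * \<eta> < \<epsilon>"
  proof -
    show "\<eta> > 0" "\<eta> \<le> e"
      using k \<open>\<epsilon> > 0\<close> by (auto simp: \<eta>_def)
    have "L * \<eta> < (L + 1) * \<eta>" using \<open>\<eta> > 0\<close> by simp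
    also have "\<dots> \<le> (L + 1) * (\<epsilon> / (L + 1))"
      using k by (intro mult_left_mono) (auto simp: \<eta>_def)
    finally show "L * \<eta> < \<epsilon>" using k by simp
  qed
  obtain \<delta> where \<delta>: "\<delta> > 0"
    "\<And>t. \<bar>t - c\<bar> < \<delta> \<Longrightarrow> t \<le> b \<Longrightarrow> segment y t \<in> hist_ball k \<eta> (segment y c)"
    using segment_near[OF y, of c \<eta> k] c I \<eta> k by blast
  show "\<exists>d>0. \<forall>t\<in>I. dist t c < d \<longrightarrow> dist (f (segment y t)) (f (segment y c)) < \<epsilon>"
  proof (intro exI[of _ \<delta>] conjI ballI impI)
    fix t assume "t \<in> I" "dist t c < \<delta>"
    then have t: "segment y t \<in> hist_ball k \<eta> (segment y c)"
      using \<delta> I by (auto simp: dist_real_def)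
    have "dist (f (segment y t)) (f (segment y c)) \<le> L * \<eta>"
    proof (rule L)
      show "segment y t \<in> hist_ball k e (segment y c)"
        using t hist_ball_mono[OF order_refl \<eta>(2)] by blast
      show "dist (happ (segment y t) s) (happ (segment y c) s) \<le> \<eta>" if "s \<in> {-k..0}" for s
        using hist_ballD[OF t] that by (simp add: less_imp_le)
    qed (use hist_ball_self k in auto)
    with \<eta> show "dist (f (segment y t)) (f (segment y c)) < \<epsilon>" by simp
  qed (use \<delta> in auto)
qed

section \<open>Uniqueness\<close>

text \<open>Let \<open>c\<close> be the infimum of the times of disagreement. On a short window
  after \<open>c\<close>, the largest distance \<open>M\<close> is at most \<open>L * M * d\<close>,
  hence at most \<open>M / 2\<close>, so it vanishes and the solutions agree beyond
  \<open>c\<close>.\<close>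

lemma solution_unique:
  assumes y: "delay_solution U f {0..b} y" and z: "delay_solution U f {0..b} z"
    and "0 \<le> b" and seg: "segment y 0 = segment z 0" and "t \<le> b"
  shows "y t = z t"
proof (rule ccontr)
  note Y = y[unfolded delay_solution_Icc[OF \<open>0 \<le> b\<close>]]
    and Z = z[unfolded delay_solution_Icc[OF \<open>0 \<le> b\<close>]]
  have neg: "y s = z s" if "s \<le> 0" for s
    using happ_segment[of b y 0 s] happ_segment[of b z 0 s] Y Z \<open>0 \<le> b\<close> that seg by simp
  assume ne: "y t \<noteq> z t"
  then have "0 \<le> t" using neg[of t] by linarith
  define D where "D = {s \<in> {0..b}. y s \<noteq> z s}"
  define c where "c = Inf D"
  have D: "t \<in> D" "bdd_below D"
    using ne \<open>0 \<le> t\<close> \<open>t \<le> b\<close> by (auto simp: D_def)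
  have c: "0 \<le> c" "c \<le> t"
    unfolding c_def using D by (auto intro!: cInf_greatest cInf_lower simp: D_def)
  have below: "y s = z s" if "s < c" for s
  proof (rule ccontr)
    assume "y s \<noteq> z s"
    then have "s \<in> D" using neg[of s] that c \<open>t \<le> b\<close> by (force simp: D_def)
    then show False using cInf_lower[OF _ D(2)] that c_def by force
  qed
  have yz: "continuous_on {..b} (\<lambda>s. y s - z s)"
    using Y Z by (intro continuous_intros) auto
  have "y c - z c = 0"
  proof (rule continuous_constant_on_closure[of "{..<c}" "\<lambda>s. y s - z s"])
    show "continuous_on (closure {..<c}) (\<lambda>s. y s - z s)"
      by (rule continuous_on_subset[OF yz]) (use c \<open>t \<le> b\<close> in auto)
  qed (use below in auto)
  then have upto: "y s = z s" if "s \<le> c" for s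
    using below that by (cases "s = c") auto
  have "c \<noteq> t" using ne upto by blast
  with c have "c < t" by simp
  have cU: "segment y c \<in> U" and segc: "segment z c = segment y c"
    using Y c \<open>t \<le> b\<close> upto by (auto intro: segment_cong)
  obtain k e L where k: "0 \<le> k" "0 < e" "0 \<le> L"
    and L: "\<And>\<phi> \<xi> M. \<lbrakk>\<phi> \<in> hist_ball k e (segment y c); \<xi> \<in> hist_ball k e (segment y c);
      \<And>s. s \<in> {-k..0} \<Longrightarrow> dist (happ \<phi> s) (happ \<xi> s) \<le> M\<rbrakk> \<Longrightarrow> dist (f \<phi>) (f \<xi>) \<le> L * M"
    using locally_lipschitz[OF cU] by metis
  obtain d1 where d1: "d1 > 0"
    "\<And>t. \<bar>t - c\<bar> < d1 \<Longrightarrow> t \<le> b \<Longrightarrow> segment y t \<in> hist_ball k e (segment y c)"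
    using segment_near[of b y c e k] c \<open>t \<le> b\<close> Y k by auto
  obtain d2 where d2: "d2 > 0"
    "\<And>t. \<bar>t - c\<bar> < d2 \<Longrightarrow> t \<le> b \<Longrightarrow> segment z t \<in> hist_ball k e (segment y c)"
    using segment_near[of b z c e k] c \<open>t \<le> b\<close> Z k segc by auto
  \<comment> \<open>The entries keep the window inside \<open>{0..b}\<close>, keep both segments in
    the Lipschitz ball, and give \<open>L * d \<le> 1 / 2\<close>.\<close>
  define d where "d = Min {t - c, d1 / 2, d2 / 2, 1 / (2 * (L + 1))}"
  have d: "d > 0" "d \<le> t - c" "d < d1" "d < d2"
    using \<open>c < t\<close> d1(1) d2(1) k by (auto simp: d_def min_less_iff_disj)
  have dL: "L * d \<le> 1 / 2"
  proof -
    have "L * d \<le> (L + 1) * (1 / (2 * (L + 1)))"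
      using k d(1) by (intro mult_mono) (auto simp: d_def)
    also have "\<dots> = 1 / 2" using k by (simp add: field_simps)
    finally show ?thesis .
  qed
  have "continuous_on {c..c + d} (\<lambda>s. norm (y s - z s))"
    by (intro continuous_on_norm continuous_on_subset[OF yz]) (use d \<open>t \<le> b\<close> in auto)
  then obtain m where m: "m \<in> {c..c + d}"
    "\<And>s. s \<in> {c..c + d} \<Longrightarrow> norm (y s - z s) \<le> norm (y m - z m)"
    using continuous_attains_sup[of "{c..c + d}" "\<lambda>s. norm (y s - z s)"] d(1) by auto
  define M where "M = norm (y m - z m)"
  have deriv: "norm (f (segment y s) - f (segment z s)) \<le> L * M" if s: "s \<in> {c..c + d}" for s
    unfolding dist_norm[symmetric]
  proof (rule L)
    have s': "\<bar>s - c\<bar> < d1" "\<bar>s - c\<bar> < d2" "s \<le> b"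
      using s d \<open>t \<le> b\<close> by auto
    then show "segment y s \<in> hist_ball k e (segment y c)" "segment z s \<in> hist_ball k e (segment y c)"
      using d1 d2 by auto
    fix r assume r: "r \<in> {-k..0}"
    then have "dist (happ (segment y s) r) (happ (segment z s) r) = norm (y (s + r) - z (s + r))"
      using happ_segment[of b y s r] happ_segment[of b z s r] s' Y Z by (simp add: dist_norm)
    \<comment> \<open>Looking back from \<open>s\<close>, the time \<open>s + r\<close> lies either
      before \<open>c\<close>, where the solutions agree, or in the window, where \<open>M\<close>
      is the maximum.\<close>
    also have "\<dots> \<le> M"
    proof (cases "s + r \<le> c")
      case True
      then show ?thesis using upto by (simp add: M_def)
    next
      case False
      then show ?thesis unfolding M_def using r s by (intro m(2)) auto
    qed
    finally show "dist (happ (segment y s) r) (happ (segment z s) r) \<le> M" .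
  qed
  have "norm ((y m - z m) - (y c - z c)) \<le> (L * M) * \<bar>m - c\<bar>"
  proof (rule has_vector_derivative_bound[of "{c..c + d}"])
    fix s assume s: "s \<in> {c..c + d}"
    have sub: "{c..c + d} \<subseteq> {0..b}" using c d \<open>t \<le> b\<close> by auto
    have "(y has_vector_derivative f (segment y s)) (at s within {c..c + d})"
      "(z has_vector_derivative f (segment z s)) (at s within {c..c + d})"
      using Y Z s sub by (auto intro: has_vector_derivative_within_subset[OF _ sub])
    then show "((\<lambda>s. y s - z s) has_vector_derivative f (segment y s) - f (segment z s))
        (at s within {c..c + d})"
      by (rule has_vector_derivative_diff)
    show "norm (f (segment y s) - f (segment z s)) \<le> L * M" using deriv[OF s] .
  qed (use m d in auto)
  also have "\<dots> \<le> (L * M) * d"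
    using m k by (intro mult_left_mono) (auto simp: M_def)
  also have "\<dots> \<le> M / 2"
    using mult_right_mono[OF dL, of M] by (simp add: M_def algebra_simps)
  finally have "M = 0"
    using upto[of c] by (simp add: M_def)
  obtain s where "s \<in> D" "s < c + d"
    using cInf_lessD[of D "c + d"] D d(1) c_def by auto
  moreover have "s \<ge> c" using cInf_lower[OF \<open>s \<in> D\<close> D(2)] c_def by simp
  ultimately have "norm (y s - z s) \<le> 0"
    using m(2)[of s] \<open>M = 0\<close> by (simp add: M_def)
  with \<open>s \<in> D\<close> show False by (simp add: D_def)
qed

section \<open>Local existence\<close>

text \<open>Solutions are fixed points of the integral operator \<open>\<Phi>\<close>. The radius
  \<open>e\<close> of the Lipschitz ball is split in half: one half for the movement of the old
  history under a time shift, the other for the new part \<open>u\<close>.\<close>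

lemma local_solution:
  assumes "\<psi> \<in> U"
  shows "\<exists>\<delta>>0. \<exists>y. delay_solution U f {0..\<delta>} y \<and> segment y 0 = \<psi>"
proof -
  obtain k e L where k: "0 \<le> k" "0 < e" "0 \<le> L" and ballU: "hist_ball k e \<psi> \<subseteq> U"
    and L: "\<And>\<phi> \<xi> M. \<lbrakk>\<phi> \<in> hist_ball k e \<psi>; \<xi> \<in> hist_ball k e \<psi>;
      \<And>s. s \<in> {-k..0} \<Longrightarrow> dist (happ \<phi> s) (happ \<xi> s) \<le> M\<rbrakk> \<Longrightarrow> dist (f \<phi>) (f \<xi>) \<le> L * M"
    using locally_lipschitz[OF assms] by metis
  have "uniformly_continuous_on {-k..0} (happ \<psi>)"
    by (rule compact_uniformly_continuous[OF continuous_on_subset[OF continuous_on_happ]]) auto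
  then obtain d where d: "d > 0"
    "\<And>r s. r \<in> {-k..0} \<Longrightarrow> s \<in> {-k..0} \<Longrightarrow> dist r s < d \<Longrightarrow> dist (happ \<psi> r) (happ \<psi> s) < e / 2"
    using half_gt_zero[OF \<open>0 < e\<close>] unfolding uniformly_continuous_on_def by metis
  define B where "B = norm (f \<psi>) + L * e"
  have "B \<ge> 0" using k by (simp add: B_def)
  \<comment> \<open>In order: shifts stay below the modulus \<open>d\<close> of uniform continuity;
    \<open>B * \<delta> \<le> e / 2\<close> makes \<open>\<Phi>\<close> a self-map of the ball;
    \<open>L * \<delta> \<le> 1 / 2\<close> makes it a contraction. \<open>B\<close> bounds
    \<open>f\<close> along all admissible segments.\<close>
  define \<delta> where "\<delta> = Min {d / 2, e / (2 * (B + 1)), 1 / (2 * (L + 1))}"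
  have \<delta>: "\<delta> > 0" "\<delta> < d"
    using d(1) k \<open>B \<ge> 0\<close> by (auto simp: \<delta>_def min_less_iff_disj)
  have B\<delta>: "B * \<delta> \<le> e / 2"
  proof -
    have "B * \<delta> \<le> (B + 1) * (e / (2 * (B + 1)))"
      using \<open>B \<ge> 0\<close> \<delta>(1) by (intro mult_mono) (auto simp: \<delta>_def)
    also have "\<dots> = e / 2" using \<open>B \<ge> 0\<close> by (simp add: field_simps)
    finally show ?thesis .
  qed
  have L\<delta>: "L * \<delta> \<le> 1 / 2"
  proof -
    have "L * \<delta> \<le> (L + 1) * (1 / (2 * (L + 1)))"
      using k \<delta>(1) by (intro mult_mono) (auto simp: \<delta>_def)
    also have "\<dots> = 1 / 2" using k by (simp add: field_simps)
    finally show ?thesis .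
  qed
  \<comment> \<open>The unknown \<open>u\<close> is the deviation of the solution from the constant \<open>happ \<psi> 0\<close>; only fixed
    points satisfy \<open>u 0 = 0\<close>, so that \<open>Y u\<close> need not start in \<open>\<psi>\<close> during the iteration.\<close>
  define Y where "Y u t = happ \<psi> (min t 0) + apply_bcontfun u (max t 0)" for u :: "real \<Rightarrow>\<^sub>C 'a" and t
  have contY: "continuous_on A (Y u)" for A u
    unfolding Y_def
    by (intro continuous_on_add continuous_on_compose2[OF continuous_on_happ]
        continuous_on_compose2[OF continuous_on_apply_bcontfun[of UNIV]] continuous_intros) auto
  have segY: "happ (segment (Y u) t) s = Y u (t + s)" if "s \<le> 0" for u t s
    using happ_segment[OF contY order_refl that] .
  have ballY: "segment (Y u) t \<in> hist_ball k e \<psi>" if u: "u \<in> cball 0 (e / 2)" and t: "t \<in> {0..\<delta>}" for u t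
    unfolding hist_ball_def
  proof safe
    fix s assume s: "s \<in> {-k..0}"
    have "dist (happ \<psi> (min (t + s) 0)) (happ \<psi> s) < e / 2"
      by (rule d(2)) (use s t k \<delta> in \<open>auto simp: dist_real_def min_def\<close>)
    moreover have "norm (apply_bcontfun u (max (t + s) 0)) \<le> e / 2"
      using norm_bounded[of u "max (t + s) 0"] u by simp
    ultimately have "dist (Y u (t + s)) (happ \<psi> s) < e"
      unfolding Y_def dist_norm
      using norm_triangle_ineq[of "happ \<psi> (min (t + s) 0) - happ \<psi> s" "apply_bcontfun u (max (t + s) 0)"]
      by (simp add: algebra_simps)
    then show "dist (happ (segment (Y u) t) s) (happ \<psi> s) < e"
      using s by (simp add: segY)
  qed
  have contf: "continuous_on {0..r} (\<lambda>t. f (segment (Y u) t))"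
    if "u \<in> cball 0 (e / 2)" "r \<le> \<delta>" for u r
    by (rule continuous_on_vector_field[where b = \<delta>, OF contY]) (use ballY[OF that(1)] ballU that in auto)
  have boundf: "norm (f (segment (Y u) t)) \<le> B" if "u \<in> cball 0 (e / 2)" "t \<in> {0..\<delta>}" for u t
  proof -
    have "dist (f (segment (Y u) t)) (f \<psi>) \<le> L * e"
      by (rule L) (use ballY[OF that] k hist_ball_self less_imp_le[OF hist_ballD[OF ballY[OF that]]] in auto)
    then show ?thesis
      using norm_triangle_sub[of "f (segment (Y u) t)" "f \<psi>"] by (simp add: B_def dist_norm)
  qed
  \<comment> \<open>Clamping time to \<open>{0..\<delta>}\<close> makes \<open>G u\<close> a bounded
    continuous function on the whole line, as the type of \<open>u\<close> requires.\<close>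
  define c where "c t = max 0 (min \<delta> t)" for t
  have c: "c t \<in> {0..\<delta>}" for t using \<delta>(1) by (auto simp: c_def)
  define G where "G u t = integral {0..c t} (\<lambda>r. f (segment (Y u) r))" for u t
  have Gbound: "norm (G u t) \<le> e / 2" if "u \<in> cball 0 (e / 2)" for u t
  proof -
    have "norm (G u t) \<le> B * (c t - 0)"
      unfolding G_def by (rule integral_bound) (use contf[OF that] boundf[OF that] c[of t] in auto)
    also have "\<dots> \<le> B * \<delta>"
      using c[of t] \<open>B \<ge> 0\<close> by (intro mult_left_mono) auto
    finally show ?thesis using B\<delta> by simp
  qed
  have Gcont: "continuous_on UNIV (G u)" if "u \<in> cball 0 (e / 2)" for u
  proof -
    have "continuous_on {0..\<delta>} (\<lambda>x. integral {0..x} (\<lambda>r. f (segment (Y u) r)))"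
      by (intro indefinite_integral_continuous_1 integrable_continuous_real contf[OF that]) simp
    moreover have "continuous_on UNIV c"
      unfolding c_def by (intro continuous_intros)
    ultimately show ?thesis
      unfolding G_def by (rule continuous_on_compose2) (use c in auto)
  qed
  define \<Phi> where "\<Phi> u = Bcontfun (G u)" for u
  have \<Phi>: "apply_bcontfun (\<Phi> u) = G u" if "u \<in> cball 0 (e / 2)" for u
    unfolding \<Phi>_def by (rule Bcontfun_inverse[OF bcontfun_normI[OF Gcont Gbound]]) (use that in auto)
  have "\<exists>!u\<in>cball 0 (e / 2). \<Phi> u = u"
  proof (rule Banach_fix[of _ "1 / 2"])
    show "complete (cball (0 :: real \<Rightarrow>\<^sub>C 'a) (e / 2))"
      by (simp add: complete_eq_closed)
    show "\<Phi> ` cball 0 (e / 2) \<subseteq> cball 0 (e / 2)"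
    proof (rule image_subsetI)
      fix u :: "real \<Rightarrow>\<^sub>C 'a" assume "u \<in> cball 0 (e / 2)"
      then have "norm (\<Phi> u) \<le> e / 2"
        by (intro norm_bound) (simp only: \<Phi> Gbound)
      then show "\<Phi> u \<in> cball 0 (e / 2)" by simp
    qed
    fix u v :: "real \<Rightarrow>\<^sub>C 'a" assume u: "u \<in> cball 0 (e / 2)" and v: "v \<in> cball 0 (e / 2)"
    show "dist (\<Phi> u) (\<Phi> v) \<le> 1 / 2 * dist u v"
    proof (rule dist_bound)
      fix t
      have lip: "norm (f (segment (Y u) r) - f (segment (Y v) r)) \<le> L * dist u v" if "r \<in> {0..\<delta>}" for r
        unfolding dist_norm[symmetric]
      proof (rule L[OF ballY[OF u that] ballY[OF v that]])
        fix s assume "s \<in> {-k..0}"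
        then show "dist (happ (segment (Y u) r) s) (happ (segment (Y v) r) s) \<le> dist u v"
          using dist_bounded[of u "max (r + s) 0" v] by (simp add: segY Y_def)
      qed
      have int: "(\<lambda>r. f (segment (Y w) r)) integrable_on {0..c t}" if "w \<in> cball 0 (e / 2)" for w
        by (intro integrable_continuous_real contf[OF that]) (use c[of t] in simp)
      have "dist (\<Phi> u t) (\<Phi> v t)
          = norm (integral {0..c t} (\<lambda>r. f (segment (Y u) r) - f (segment (Y v) r)))"
        by (simp add: \<Phi>[OF u] \<Phi>[OF v] G_def dist_norm integral_diff[OF int[OF u] int[OF v]])
      also have "\<dots> \<le> L * dist u v * (c t - 0)"
        by (rule integral_bound)
          (use c[of t] lip contf[OF u, of "c t"] contf[OF v, of "c t"] in \<open>auto intro!: continuous_intros\<close>)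
      also have "\<dots> \<le> L * dist u v * \<delta>"
        using c[of t] k by (intro mult_left_mono) auto
      also have "\<dots> \<le> 1 / 2 * dist u v"
        using mult_right_mono[OF L\<delta>, of "dist u v"] by (simp add: algebra_simps)
      finally show "dist (\<Phi> u t) (\<Phi> v t) \<le> 1 / 2 * dist u v" .
    qed
  qed (use k in auto)
  then obtain u where u: "u \<in> cball 0 (e / 2)" and fixpoint: "\<Phi> u = u" by blast
  have uG: "apply_bcontfun u t = G u t" for t
    using \<Phi>[OF u] fixpoint by simp
  have u0: "apply_bcontfun u 0 = 0"
    unfolding uG using \<delta>(1) by (simp add: G_def c_def)
  have seg0: "segment (Y u) 0 = \<psi>"
    by (rule hist_eqI) (simp add: segY, simp add: Y_def u0)
  have "delay_solution U f {0..\<delta>} (Y u)"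
    unfolding delay_solution_Icc[OF less_imp_le[OF \<delta>(1)]]
  proof (intro conjI ballI contY)
    fix t assume t: "t \<in> {0..\<delta>}"
    show "segment (Y u) t \<in> U" using ballY[OF u t] ballU by blast
    have "((\<lambda>x. happ \<psi> 0 + integral {0..x} (\<lambda>r. f (segment (Y u) r)))
        has_vector_derivative 0 + f (segment (Y u) t)) (at t within {0..\<delta>})"
      by (intro has_vector_derivative_add has_vector_derivative_const
          integral_has_vector_derivative contf[OF u] t) simp
    then show "(Y u has_vector_derivative f (segment (Y u) t)) (at t within {0..\<delta>})"
      by (intro has_vector_derivative_transform[OF t,
            of "Y u" "\<lambda>x. happ \<psi> 0 + integral {0..x} (\<lambda>r. f (segment (Y u) r))"])
        (auto simp: Y_def uG G_def c_def)
  qed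
  then show ?thesis using \<delta>(1) seg0 by blast
qed

section \<open>Maximal solutions and the exit time\<close>

text \<open>Being a solution is a local property, and every \<open>t\<close> below \<open>T\<close>
  has some \<open>b\<close> strictly between it and \<open>T\<close>, so near \<open>t\<close> the
  half-open interval looks like \<open>{0..b}\<close>. \<open>T\<close> may be infinite.\<close>

lemma delay_solution_if_Icc:
  assumes "0 < T" and sol: "\<And>b. 0 \<le> b \<Longrightarrow> ereal b < T \<Longrightarrow> delay_solution U f {0..b} y"
  shows "delay_solution U f {t. 0 \<le> t \<and> ereal t < T} y"
  unfolding delay_solution_def history_less_ereal[OF \<open>0 < T\<close>]
proof (intro conjI ballI)
  let ?I = "{t. 0 \<le> t \<and> ereal t < T}"
  have ex: "\<exists>b>t. 0 \<le> b \<and> ereal b < T" if "ereal t < T" for t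
  proof -
    have "ereal (max t 0) < T" using that assms(1) by (simp add: max_def zero_ereal_def)
    then obtain b where "ereal (max t 0) < ereal b" "ereal b < T"
      using ereal_dense2 by blast
    then show ?thesis by (intro exI[of _ b]) auto
  qed
  show "is_interval ?I"
    unfolding is_interval_1 by (auto intro: order.strict_trans1[OF ereal_less_eq(3)[THEN iffD2]])
  have "isCont y t" if t: "ereal t < T" for t
  proof -
    obtain b where b: "t < b" "0 \<le> b" "ereal b < T" using ex[OF t] by blast
    have "continuous_on {..b} y"
      using sol[OF b(2,3)] by (simp add: delay_solution_Icc[OF b(2)])
    then have "continuous_on {..<b} y"
      by (rule continuous_on_subset) auto
    then show ?thesis using b(1) by (simp add: continuous_on_eq_continuous_at)
  qed
  then show "continuous_on {t. ereal t < T} y"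
    by (intro continuous_at_imp_continuous_on) blast
  fix t assume t: "t \<in> ?I"
  then obtain b where b: "t < b" "0 \<le> b" "ereal b < T" using ex by blast
  then have *: "segment y t \<in> U" "(y has_vector_derivative f (segment y t)) (at t within {0..b})"
    using sol[OF b(2,3)] t unfolding delay_solution_Icc[OF b(2)] by auto
  then show "segment y t \<in> U" by simp
  have "at t within ?I = at t within {0..b}"
    by (rule at_within_nhd[of t "{..<b}"])
      (use b in \<open>auto intro: order.strict_trans1[of "ereal _" "ereal b"]\<close>)
  with * show "(y has_vector_derivative f (segment y t)) (at t within ?I)" by simp
qed

text \<open>\<open>T\<close> is the supremum of the right ends of all compact solution intervals;
  uniqueness lets the solutions on them be patched together.\<close>

lemma maximal_solution_exists:
  assumes "\<psi> \<in> U"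
  shows "\<exists>T y. maximal_solution U f \<psi> T y"
proof -
  define S where "S = {b. 0 \<le> b \<and> (\<exists>y. delay_solution U f {0..b} y \<and> segment y 0 = \<psi>)}"
  define T where "T = Sup (ereal ` S)"
  have T: "ereal b \<le> T" if "b \<in> S" for b
    unfolding T_def using that by (simp add: Sup_upper)
  obtain Y where Y: "\<And>b. b \<in> S \<Longrightarrow> delay_solution U f {0..b} (Y b) \<and> segment (Y b) 0 = \<psi>"
    using bchoice[of S "\<lambda>b y. delay_solution U f {0..b} y \<and> segment y 0 = \<psi>"]
    unfolding S_def by blast
  have S0: "0 \<le> b" if "b \<in> S" for b using that by (simp add: S_def)
  have agree: "Y b t = Y b' t" if "b \<in> S" "b' \<in> S" "t \<le> b" "t \<le> b'" for b b' t
  proof (rule solution_unique[of "min b b'"])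
    show "delay_solution U f {0..min b b'} (Y b)"
      by (rule delay_solution_subset[of U f "{0..b}"]) (use Y that in \<open>auto simp: is_interval_cc\<close>)
    show "delay_solution U f {0..min b b'} (Y b')"
      by (rule delay_solution_subset[of U f "{0..b'}"]) (use Y that in \<open>auto simp: is_interval_cc\<close>)
  qed (use Y that S0 in auto)
  \<comment> \<open>By \<open>agree\<close> the value does not depend on the chosen
    \<open>b\<close>.\<close>
  define y where "y t = Y (SOME b. b \<in> S \<and> t \<le> b) t" for t
  have y: "y t = Y b t" if "b \<in> S" "t \<le> b" for b t
    unfolding y_def by (rule someI2[of _ b]) (use that in \<open>auto intro: agree\<close>)
  have solS: "delay_solution U f {0..b} y" "segment y 0 = \<psi>" if "b \<in> S" for b
  proof -
    show "delay_solution U f {0..b} y"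
      by (rule delay_solution_cong[of _ _ _ "Y b"]) (use Y y that in auto)
    show "segment y 0 = \<psi>"
      using Y[OF that] segment_cong[of 0 y "Y b"] y[OF that] S0[OF that] by simp
  qed
  obtain \<delta> where \<delta>: "\<delta> > 0" "\<delta> \<in> S"
    using local_solution[OF assms] by (auto simp: S_def)
  have "0 < T" using T[OF \<delta>(2)] \<delta>(1) by (metis ereal_less(2) less_le_trans)
  let ?I = "{t. 0 \<le> t \<and> ereal t < T}"
  have solI: "delay_solution U f ?I y"
  proof (rule delay_solution_if_Icc[OF \<open>0 < T\<close>])
    fix b assume b: "0 \<le> b" "ereal b < T"
    then obtain b' where "b' \<in> S" "b < b'" unfolding T_def less_Sup_iff by auto
    then show "delay_solution U f {0..b} y"
      using delay_solution_subset[OF solS(1)[of b'], of "{0..b}"] by (simp add: is_interval_cc)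
  qed
  have max: "J = ?I" if J: "?I \<subseteq> J" "J \<subseteq> {0..}" "delay_solution U f J z"
    and zy: "\<And>s. ereal s < T \<Longrightarrow> z s = y s" for J z
  proof (rule ccontr)
    assume "J \<noteq> ?I"
    \<comment> \<open>A proper extension reaches some \<open>j\<close> at or above \<open>T\<close>,
      so \<open>T\<close> is a real number \<open>r\<close> and \<open>{0..r}\<close> lies in
      \<open>J\<close>. Restarting at \<open>r\<close> then gives an element of \<open>S\<close>
      above its supremum.\<close>
    with J(1,2) obtain j where j: "j \<in> J" "0 \<le> j" "\<not> ereal j < T" by blast
    then have "T \<le> ereal j" by simp
    with \<open>0 < T\<close> obtain r where r: "T = ereal r" using \<open>0 < T\<close> by (cases T) auto
    have r0: "0 < r" "r \<le> j" using \<open>0 < T\<close> \<open>T \<le> ereal j\<close> r by auto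
    have "{0..r} \<subseteq> J"
    proof
      fix x assume "x \<in> {0..r}"
      moreover have "0 \<in> J" using J(1) \<open>0 < T\<close> by (auto simp: zero_ereal_def)
      ultimately show "x \<in> J"
        using mem_is_interval_1_I[of J 0 j x] J(3) j(1) r0 by (simp add: delay_solution_def)
    qed
    then have solr: "delay_solution U f {0..r} z"
      by (rule delay_solution_subset[OF J(3)]) (simp add: is_interval_cc)
    have z0: "segment z 0 = \<psi>"
      using segment_cong[of 0 z y] zy solS(2)[OF \<delta>(2)] r0 r by simp
    have "segment z r \<in> U" using solr r0 by (simp add: delay_solution_def)
    from local_solution[OF this] obtain \<epsilon> w where
      w: "\<epsilon> > 0" "delay_solution U f {0..\<epsilon>} w" "segment w 0 = segment z r" by blast
    note app = delay_solution_append[OF solr w(2) _ _ w(3)]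
    have "segment (\<lambda>t. w (t - r)) 0 = segment z 0"
      by (rule segment_cong) (use app(2) r0 w(1) in auto)
    then have "r + \<epsilon> \<in> S"
      unfolding S_def using app(1) r0 w(1) z0 by auto
    from T[OF this] show False using r w(1) by simp
  qed
  show ?thesis
    unfolding maximal_solution_def
    using \<open>0 < T\<close> solI solS(2)[OF \<delta>(2)] max by blast
qed

text \<open>If \<open>b\<close> were at or beyond \<open>T\<close>, then \<open>T\<close> would be a
  real \<open>r\<close> and \<open>z\<close> on \<open>{0..r}\<close> would properly extend
  \<open>y\<close>, against maximality. The agreement needed for this is first shown strictly below
  \<open>T\<close>.\<close>

lemma solution_within_maximal:
  assumes y: "maximal_solution U f \<psi> T y" and z: "delay_solution U f {0..b} z" "segment z 0 = \<psi>"
    and "0 \<le> b"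
  shows "ereal b < T" and "\<And>t. t \<le> b \<Longrightarrow> z t = y t"
proof -
  let ?I = "{t. 0 \<le> t \<and> ereal t < T}"
  have T: "0 < T" and solI: "delay_solution U f ?I y" and y0: "segment y 0 = \<psi>"
    using y by (auto simp: maximal_solution_def)
  have eq: "z t = y t" if "t \<le> b'" "0 \<le> b'" "b' \<le> b" "ereal b' < T" for t b'
  proof (rule solution_unique[of b'])
    show "delay_solution U f {0..b'} z"
      by (rule delay_solution_subset[OF z(1)]) (use that in \<open>auto simp: is_interval_cc\<close>)
    show "delay_solution U f {0..b'} y"
      by (rule delay_solution_subset[OF solI])
        (use that in \<open>auto simp: is_interval_cc intro: order.strict_trans1[of "ereal _" "ereal b'"]\<close>)
  qed (use that y0 z in auto)
  show bT: "ereal b < T"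
  proof (rule ccontr)
    assume "\<not> ereal b < T"
    then obtain r where r: "T = ereal r" "r \<le> b" using T by (cases T) auto
    then have "0 < r" using T by simp
    have "{0..r} = ?I"
    proof -
      have "delay_solution U f {0..r} z"
        by (rule delay_solution_subset[OF z(1)]) (use r in \<open>auto simp: is_interval_cc\<close>)
      moreover have "\<forall>s. ereal s < T \<longrightarrow> z s = y s"
      proof (intro allI impI)
        fix s assume "ereal s < T"
        then show "z s = y s"
          using r \<open>0 < r\<close> by (intro eq[of s "max s 0"]) auto
      qed
      moreover have "?I \<subseteq> {0..r}" "{0..r} \<subseteq> {0..}" using r by auto
      ultimately show ?thesis using y unfolding maximal_solution_def by blast
    qed
    moreover have "r \<in> {0..r}" "r \<notin> ?I" using r \<open>0 < r\<close> by auto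
    ultimately show False by blast
  qed
  show "z t = y t" if "t \<le> b" for t
    by (rule eq[OF that \<open>0 \<le> b\<close> order_refl bT])
qed

lemma maximal_solution_Icc:
  assumes "maximal_solution U f \<psi> T y" "0 \<le> b" "ereal b < T"
  shows "delay_solution U f {0..b} y" "segment y 0 = \<psi>"
proof -
  have "delay_solution U f {t. 0 \<le> t \<and> ereal t < T} y"
    using assms(1) by (simp add: maximal_solution_def)
  then show "delay_solution U f {0..b} y"
    by (rule delay_solution_subset)
      (use assms in \<open>auto simp: is_interval_cc intro: order.strict_trans1[of "ereal _" "ereal b"]\<close>)
qed (use assms in \<open>simp add: maximal_solution_def\<close>)

text \<open>Justifies the \<open>THE\<close> and the \<open>SOME\<close>: if one exit time
  \<open>T2 = ereal r\<close> were smaller than another, the longer solution restricted to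
  \<open>{0..r}\<close> would give \<open>r < r\<close> by
  \<open>solution_within_maximal\<close>.\<close>

lemma maximal_solution_max_solution:
  assumes "\<psi> \<in> U"
  shows "maximal_solution U f \<psi> (exit_time U f \<psi>) (max_solution U f \<psi>)"
proof -
  obtain T y where y: "maximal_solution U f \<psi> T y"
    using maximal_solution_exists[OF assms] by blast
  have le: "T1 \<le> T2" if 1: "maximal_solution U f \<psi> T1 y1" and 2: "maximal_solution U f \<psi> T2 y2"
    for T1 T2 y1 y2
  proof (rule ccontr)
    assume "\<not> T1 \<le> T2"
    moreover have "0 < T2" using 2 by (simp add: maximal_solution_def)
    ultimately obtain r where r: "T2 = ereal r" "0 < r" "ereal r < T1"
      by (cases T2) auto
    from solution_within_maximal(1)[OF 2 maximal_solution_Icc[OF 1 _ r(3)]] r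
    show False by simp
  qed
  have "exit_time U f \<psi> = T"
    unfolding exit_time_def
  proof (rule the_equality)
    show "T' = T" if "\<exists>y. maximal_solution U f \<psi> T' y" for T'
      using that le[OF y] le[OF _ y] by (elim exE) (rule antisym)
  qed (use y in blast)
  with y have "maximal_solution U f \<psi> (exit_time U f \<psi>) y" by simp
  then show ?thesis
    unfolding max_solution_def by (rule someI[of "maximal_solution U f \<psi> (exit_time U f \<psi>)"])
qed

section \<open>Semiflow laws\<close>

text \<open>Together with the converse \<open>semiflow_domainE\<close> this hides maximality: from
  here on the semiflow is computed from any solution on \<open>{0..b}\<close>.\<close>

lemma semiflow_eqI:
  assumes "\<psi> \<in> U" "delay_solution U f {0..b} z" "segment z 0 = \<psi>" "0 \<le> b"
  shows "(b, \<psi>) \<in> semiflow_domain U f" "semiflow U f (b, \<psi>) = segment z b"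
proof -
  note * = solution_within_maximal[OF maximal_solution_max_solution[OF assms(1)] assms(2-4)]
  show "(b, \<psi>) \<in> semiflow_domain U f"
    using *(1) assms by (simp add: semiflow_domain_def)
  show "semiflow U f (b, \<psi>) = segment z b"
    unfolding semiflow_def using *(2) by (auto intro: segment_cong)
qed

lemma semiflow_domainE:
  assumes "(b, \<psi>) \<in> semiflow_domain U f"
  obtains z where "0 \<le> b" "\<psi> \<in> U" "delay_solution U f {0..b} z" "segment z 0 = \<psi>"
    "semiflow U f (b, \<psi>) = segment z b"
proof -
  have b: "0 \<le> b" "\<psi> \<in> U" "ereal b < exit_time U f \<psi>"
    using assms by (auto simp: semiflow_domain_def)
  show thesis
    using that[OF b(1,2) maximal_solution_Icc[OF maximal_solution_max_solution[OF b(2)] b(1,3)]]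
    by (simp add: semiflow_def)
qed

lemma semiflow_zero:
  assumes "\<psi> \<in> U"
  shows "(0, \<psi>) \<in> semiflow_domain U f" "semiflow U f (0, \<psi>) = \<psi>"
proof -
  obtain \<delta> y where \<delta>: "\<delta> > 0" "delay_solution U f {0..\<delta>} y" and y0: "segment y 0 = \<psi>"
    using local_solution[OF assms] by blast
  have "delay_solution U f {0..0} y"
    by (rule delay_solution_subset[OF \<delta>(2) _ is_interval_cc]) (use \<delta>(1) in auto)
  from semiflow_eqI[OF assms this y0] y0
  show "(0, \<psi>) \<in> semiflow_domain U f" "semiflow U f (0, \<psi>) = \<psi>" by auto
qed

lemma semiflow_add:
  assumes "(a, \<psi>) \<in> semiflow_domain U f" "(b, semiflow U f (a, \<psi>)) \<in> semiflow_domain U f"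
  shows "(a + b, \<psi>) \<in> semiflow_domain U f"
    and "semiflow U f (a + b, \<psi>) = semiflow U f (b, semiflow U f (a, \<psi>))"
proof -
  obtain y where y: "0 \<le> a" "\<psi> \<in> U" "delay_solution U f {0..a} y" "segment y 0 = \<psi>"
    "semiflow U f (a, \<psi>) = segment y a"
    using semiflow_domainE[OF assms(1)] by metis
  obtain z where z: "0 \<le> b" "delay_solution U f {0..b} z" "segment z 0 = segment y a"
    "semiflow U f (b, semiflow U f (a, \<psi>)) = segment z b"
    using semiflow_domainE[OF assms(2)] y(5) by metis
  note app = delay_solution_append[OF y(3) z(2) y(1) z(1,3)]
  have "segment (\<lambda>t. z (t - a)) 0 = \<psi>"
    unfolding y(4)[symmetric] by (rule segment_cong) (use app(2) y(1) in auto)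
  from semiflow_eqI[OF y(2) app(1) this] y(1) z
  show "(a + b, \<psi>) \<in> semiflow_domain U f"
    and "semiflow U f (a + b, \<psi>) = semiflow U f (b, semiflow U f (a, \<psi>))"
    by (auto simp: segment_shift)
qed

end

subsection \<open>Smooth maps are locally Lipschitz\<close>

lemma has_dir_deriv_unique: "has_dir_deriv h u v l \<Longrightarrow> has_dir_deriv h u v l' \<Longrightarrow> l = l'"
  unfolding has_dir_deriv_def by (rule tendsto_unique[of "at 0"]) auto

lemma has_dir_deriv_dir_deriv: "\<exists>l. has_dir_deriv h u v l \<Longrightarrow> has_dir_deriv h u v (dir_deriv h u v)"
  unfolding dir_deriv_def by (rule theI') (auto intro: has_dir_deriv_unique)

lemma dir_deriv_eqI: "has_dir_deriv h u v l \<Longrightarrow> dir_deriv h u v = l"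
  using has_dir_deriv_dir_deriv has_dir_deriv_unique by blast

lemma has_dir_deriv_zero: "has_dir_deriv h u 0 0"
  by (simp add: has_dir_deriv_def)

text \<open>Substituting \<open>t * c\<close> for \<open>t\<close> in the difference quotient gives
  homogeneity for both kinds of smoothness, including \<open>C1_MB\<close>, whose definition asserts
  no linearity.\<close>

lemma has_dir_deriv_scaleR:
  assumes "has_dir_deriv h u v l" "c \<noteq> 0"
  shows "has_dir_deriv h u (c *\<^sub>R v) (c *\<^sub>R l)"
proof -
  have "filterlim (\<lambda>t. t * c) (at 0) (at (0::real))"
    using assms(2) by (intro filterlim_atI tendsto_eq_intros) (auto simp: eventually_at intro: exI[of _ 1])
  from filterlim_compose[OF assms(1)[unfolded has_dir_deriv_def] this]
  have "((\<lambda>t. c *\<^sub>R ((1 / (t * c)) *\<^sub>R (h (u + (t * c) *\<^sub>R v) - h u))) \<longlongrightarrow> c *\<^sub>R l) (at 0)"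
    by (intro tendsto_scaleR_tvs tendsto_const)
  then show ?thesis
    using assms(2) by (simp add: has_dir_deriv_def)
qed

lemma has_vector_derivative_along_line:
  fixes h :: "'a::topological_real_vector \<Rightarrow> 'b::real_normed_vector"
  assumes "has_dir_deriv h (u + t *\<^sub>R v) v l"
  shows "((\<lambda>t. h (u + t *\<^sub>R v)) has_vector_derivative l) (at t)"
  unfolding has_vector_derivative_def has_derivative_at
proof (intro conjI bounded_linear_scaleR_left)
  have "((\<lambda>s. norm ((1 / s) *\<^sub>R (h (u + t *\<^sub>R v + s *\<^sub>R v) - h (u + t *\<^sub>R v)) - l)) \<longlongrightarrow> 0) (at 0)"
    using assms unfolding has_dir_deriv_def by (intro tendsto_norm_zero) (simp add: LIM_zero_iff)
  then show "((\<lambda>s. norm (h (u + (t + s) *\<^sub>R v) - h (u + t *\<^sub>R v) - s *\<^sub>R l) / norm s) \<longlongrightarrow> 0) (at 0)"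
  proof (rule Lim_transform_eventually)
    have "norm ((1 / s) *\<^sub>R (h (u + t *\<^sub>R v + s *\<^sub>R v) - h (u + t *\<^sub>R v)) - l)
        = norm (h (u + (t + s) *\<^sub>R v) - h (u + t *\<^sub>R v) - s *\<^sub>R l) / norm s" if "s \<noteq> 0" for s
    proof -
      have "(1 / s) *\<^sub>R (h (u + t *\<^sub>R v + s *\<^sub>R v) - h (u + t *\<^sub>R v)) - l
          = (1 / s) *\<^sub>R (h (u + (t + s) *\<^sub>R v) - h (u + t *\<^sub>R v) - s *\<^sub>R l)"
        using that by (simp add: scaleR_add_left scaleR_diff_right add.assoc)
      then show ?thesis by (simp add: divide_inverse mult.commute)
    qed
    then show "\<forall>\<^sub>F s in at 0. norm ((1 / s) *\<^sub>R (h (u + t *\<^sub>R v + s *\<^sub>R v) - h (u + t *\<^sub>R v)) - l)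
        = norm (h (u + (t + s) *\<^sub>R v) - h (u + t *\<^sub>R v) - s *\<^sub>R l) / norm s"
      by (auto simp: eventually_at intro: exI[of _ 1])
  qed
qed

section \<open>Lipschitz estimates from bounded directional derivatives\<close>

text \<open>One radius serves both factors, so that one scalar brings a direction into the ball
  around 0. Convexity keeps the segments of the mean value argument inside.\<close>

definition prod_ball :: "real \<Rightarrow> real \<Rightarrow> real \<times> 'a::real_normed_vector hist \<Rightarrow> (real \<times> 'a hist) set"
  where "prod_ball k e u = ball (fst u) e \<times> hist_ball k e (snd u)"

lemma prod_ball_mono:
  assumes "k' \<le> k" "e \<le> e'"
  shows "prod_ball k e u \<subseteq> prod_ball k' e' u"
  unfolding prod_ball_def
  using subset_ball[OF assms(2), of "fst u"] hist_ball_mono[OF assms, of "snd u"] by (rule Sigma_mono)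

lemma open_contains_hist_ball:
  assumes "open S" "\<phi> \<in> S"
  shows "\<exists>k. \<exists>e>0. hist_ball k e \<phi> \<subseteq> S"
  using assms unfolding open_hist_def hist_ball_def by (rule bspec)

lemma open_contains_prod_ball:
  assumes "open S" "u \<in> S"
  shows "\<exists>k e. 0 \<le> k \<and> 0 < e \<and> prod_ball k e u \<subseteq> S"
proof -
  obtain A B where AB: "open A" "open B" "u \<in> A \<times> B" "A \<times> B \<subseteq> S"
    using open_prod_elim[OF assms] .
  obtain d where d: "d > 0" "ball (fst u) d \<subseteq> A"
    using AB(1,3) open_contains_ball by (metis mem_Times_iff)
  obtain k e where e: "e > 0" "hist_ball k e (snd u) \<subseteq> B"
    using open_contains_hist_ball[of B "snd u"] AB(2,3) by (auto simp: mem_Times_iff)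
  have "prod_ball (max k 0) (min d e) u \<subseteq> ball (fst u) d \<times> hist_ball k e (snd u)"
    unfolding prod_ball_def by (intro Sigma_mono hist_ball_mono subset_ball) auto
  also have "\<dots> \<subseteq> S"
    using AB(4) d(2) e(2) by blast
  finally have "0 \<le> max k 0 \<and> 0 < min d e \<and> prod_ball (max k 0) (min d e) u \<subseteq> S"
    using d(1) e(1) by simp
  then show ?thesis by blast
qed

lemma prod_ball_convex:
  assumes v: "v \<in> prod_ball k e u" and w: "w \<in> prod_ball k e u" and t: "t \<in> {0..1}"
  shows "v + t *\<^sub>R (w - v) \<in> prod_ball k e u"
proof -
  have eq: "x + t *\<^sub>R (y - x) = (1 - t) *\<^sub>R x + t *\<^sub>R y" for x y :: "'x::real_vector"
    by (simp add: algebra_simps)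
  have conv: "x + t *\<^sub>R (y - x) \<in> ball a e" if "x \<in> ball a e" "y \<in> ball a e"
    for a x y :: "'x::real_normed_vector"
    unfolding eq using that t by (intro convexD[OF convex_ball]) auto
  show ?thesis
    using v w conv[of "fst v" "fst u" "fst w"]
      conv[of "happ (snd v) _" "happ (snd u) _" "happ (snd w) _"]
    by (auto simp: prod_ball_def hist_ball_def mem_Times_iff dist_commute)
qed

lemma locally_bounded_imp_lipschitz:
  fixes h :: "real \<times> 'a::real_normed_vector hist \<Rightarrow> 'b::real_normed_vector"
  assumes "0 < e"
    and diff: "\<And>w v. w \<in> prod_ball k d u \<Longrightarrow> has_dir_deriv h w v (dir_deriv h w v)"
    and bound: "\<And>w v. w \<in> prod_ball k d u \<Longrightarrow> v \<in> prod_ball k e 0 \<Longrightarrow> norm (dir_deriv h w v) \<le> 1"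
    and v: "v \<in> prod_ball k d u" and w: "w \<in> prod_ball k d u"
    and M: "0 \<le> M" "dist (fst v) (fst w) \<le> M"
      "\<And>s. s \<in> {-k..0} \<Longrightarrow> dist (happ (snd v) s) (happ (snd w) s) \<le> M"
  shows "dist (h v) (h w) \<le> 2 / e * M"
proof -
  have le: "norm (h v - h w) \<le> 2 / e * M'" if "M < M'" for M'
  proof -
    have M': "M' > 0" using that M(1) by simp
    \<comment> \<open>This factor brings \<open>w - v\<close> into the ball where the derivative is
      bounded by 1; undoing it by homogeneity costs \<open>1 / c\<close>. The strict
      \<open>M < M'\<close> makes the division possible when \<open>M = 0\<close>.\<close>
    define c where "c = e / (2 * M')"
    have c: "c > 0" "c * M < e" "1 / c = 2 / e * M'"
      using M' \<open>0 < e\<close> M(1) that by (auto simp: c_def field_simps)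
    have cb: "c * x < e" if "x \<le> M" for x
      using le_less_trans[OF mult_left_mono[OF that less_imp_le[OF c(1)]] c(2)] .
    have ball: "c *\<^sub>R (w - v) \<in> prod_ball k e 0"
      using c(1) cb M(2,3)
      by (auto simp: prod_ball_def hist_ball_def mem_Times_iff dist_norm norm_minus_commute abs_mult)
    have small: "norm (dir_deriv h x (w - v)) \<le> 2 / e * M'" if x: "x \<in> prod_ball k d u" for x
    proof -
      have "dir_deriv h x (c *\<^sub>R (w - v)) = c *\<^sub>R dir_deriv h x (w - v)"
        by (rule dir_deriv_eqI[OF has_dir_deriv_scaleR[OF diff[OF x]]]) (use c in auto)
      with bound[OF x ball] c(1) have "norm (dir_deriv h x (w - v)) \<le> 1 / c"
        by (simp add: field_simps)
      then show ?thesis using c(3) by simp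
    qed
    have "norm (h (v + 0 *\<^sub>R (w - v)) - h (v + 1 *\<^sub>R (w - v))) \<le> 2 / e * M' * \<bar>0 - 1\<bar>"
    proof (rule has_vector_derivative_bound[of "{0..1}"])
      fix t :: real assume t: "t \<in> {0..1}"
      note x = prod_ball_convex[OF v w t]
      show "((\<lambda>t. h (v + t *\<^sub>R (w - v))) has_vector_derivative
          dir_deriv h (v + t *\<^sub>R (w - v)) (w - v)) (at t within {0..1})"
        by (rule has_vector_derivative_at_within[OF has_vector_derivative_along_line[OF diff[OF x]]])
      show "norm (dir_deriv h (v + t *\<^sub>R (w - v)) (w - v)) \<le> 2 / e * M'"
        by (rule small[OF x])
    qed auto
    then show ?thesis by simp
  qed
  show ?thesis
  proof (rule field_le_epsilon)
    fix \<epsilon> :: real assume "\<epsilon> > 0"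
    \<comment> \<open>The increment \<open>\<epsilon> * e / 2\<close> of \<open>M\<close> becomes
      exactly \<open>\<epsilon>\<close> after multiplication by \<open>2 / e\<close>.\<close>
    then show "dist (h v) (h w) \<le> 2 / e * M + \<epsilon>"
      using le[of "M + \<epsilon> * e / 2"] \<open>0 < e\<close> by (simp add: dist_norm field_simps)
  qed
qed

section \<open>Local boundedness of the derivative\<close>

text \<open>The derivative vanishes at \<open>(u, 0)\<close>, so joint continuity there keeps it in
  the unit ball on a product of neighbourhoods, one for points and one for directions.\<close>

lemma C1_MB_locally_bounded:
  fixes h :: "real \<times> 'a::real_normed_vector hist \<Rightarrow> 'b::real_normed_vector"
  assumes h: "C1_MB V h" and u: "u \<in> V"
  shows "\<exists>k e. 0 \<le> k \<and> 0 < e \<and> prod_ball k e u \<subseteq> V \<and>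
    (\<forall>w\<in>prod_ball k e u. \<forall>v\<in>prod_ball k e 0. norm (dir_deriv h w v) \<le> 1)"
proof -
  have cont: "continuous_on (V \<times> UNIV) (\<lambda>(u, v). dir_deriv h u v)" and "open V"
    using h by (auto simp: C1_MB_def)
  have "dir_deriv h u 0 = 0"
    by (rule dir_deriv_eqI[OF has_dir_deriv_zero])
  then obtain A where A: "open A" "(u, 0) \<in> A"
    "\<And>w v. w \<in> V \<Longrightarrow> (w, v) \<in> A \<Longrightarrow> dir_deriv h w v \<in> ball 0 1"
    using cont[unfolded continuous_on_topological, rule_format, of "(u, 0)" "ball 0 1"] u by force
  obtain A1 A2 where A12: "open A1" "open A2" "(u, 0) \<in> A1 \<times> A2" "A1 \<times> A2 \<subseteq> A"
    using open_prod_elim[OF A(1,2)] .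
  obtain k1 e1 where 1: "0 \<le> k1" "0 < e1" "prod_ball k1 e1 u \<subseteq> A1 \<inter> V"
    using open_contains_prod_ball[of "A1 \<inter> V" u] A12 u \<open>open V\<close> by auto
  obtain k2 e2 where 2: "0 \<le> k2" "0 < e2" "prod_ball k2 e2 0 \<subseteq> A2"
    using open_contains_prod_ball[of A2 0] A12 by auto
  define k e where "k = max k1 k2" and "e = min e1 e2"
  have sub: "prod_ball k e u \<subseteq> A1 \<inter> V" "prod_ball k e 0 \<subseteq> A2"
    using 1(3) 2(3) prod_ball_mono[of k1 k e e1 u] prod_ball_mono[of k2 k e e2 0]
    by (auto simp: k_def e_def)
  have "norm (dir_deriv h w v) \<le> 1" if "w \<in> prod_ball k e u" "v \<in> prod_ball k e 0" for w v
    using A(3)[of w v] A12(4) sub that by fastforce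
  moreover have "0 \<le> k" "0 < e" using 1 2 by (auto simp: k_def e_def)
  ultimately show ?thesis using sub by blast
qed

text \<open>For a fixed \<open>k\<close>, all but finitely many \<open>v j\<close> are controlled on
  \<open>{-k..0}\<close> by the hypothesis, and each remaining one is bounded there by
  compactness.\<close>

lemma tvs_bounded_range_null:
  fixes v :: "nat \<Rightarrow> real \<times> 'a::real_normed_vector hist"
  assumes v: "\<And>j. v j \<in> prod_ball (real j) (1 / real (Suc j)) 0"
  shows "tvs_bounded (range v)"
  unfolding tvs_bounded_def
proof (intro allI impI)
  fix N :: "(real \<times> 'a hist) set" assume "open N \<and> 0 \<in> N"
  then obtain k e where k: "0 \<le> k" "0 < e" "prod_ball k e 0 \<subseteq> N"
    using open_contains_prod_ball by blast
  have "\<exists>M. v j \<in> prod_ball k M 0" for j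
  proof -
    have "continuous_on {-k..0} (happ (snd (v j)))"
      by (rule continuous_on_subset[OF continuous_on_happ]) auto
    then have "bounded (happ (snd (v j)) ` {-k..0})"
      by (intro compact_imp_bounded compact_continuous_image) auto
    then obtain M where M: "\<And>s. s \<in> {-k..0} \<Longrightarrow> norm (happ (snd (v j)) s) \<le> M"
      unfolding bounded_iff by blast
    show ?thesis
      by (intro exI[of _ "max M \<bar>fst (v j)\<bar> + 1"])
        (use M in \<open>fastforce simp: prod_ball_def hist_ball_def mem_Times_iff\<close>)
  qed
  then obtain M where M: "\<And>j. v j \<in> prod_ball k (M j) 0" by metis
  define J where "J = nat \<lceil>k\<rceil>"
  \<comment> \<open>The 1 covers the indices beyond \<open>J\<close>, where the radius is
    \<open>1 / real (Suc j)\<close>; the maximum covers the finitely many others.\<close>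
  define K where "K = Max (insert 1 (M ` {..J}))"
  have "K \<ge> 1" by (simp add: K_def)
  have vK: "v j \<in> prod_ball k K 0" for j
  proof (cases "j \<le> J")
    case True
    then have "M j \<le> K" unfolding K_def by (intro Max_ge) auto
    then show ?thesis using M[of j] prod_ball_mono[of k k "M j" K 0] by auto
  next
    case False
    then have "k \<le> real j" unfolding J_def by linarith
    moreover have "1 / real (Suc j) \<le> K" using \<open>K \<ge> 1\<close> by (simp add: field_simps) (smt (verit) mult_nonneg_nonneg of_nat_0_le_iff)
    ultimately show ?thesis using v[of j] prod_ball_mono by blast
  qed
  show "\<exists>r>0. \<forall>t\<ge>r. range v \<subseteq> (\<lambda>x. t *\<^sub>R x) ` N"
  proof (intro exI[of _ "K / e"] conjI allI impI)
    show "K / e > 0" using \<open>K \<ge> 1\<close> k by simp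
    fix t assume t: "K / e \<le> t"
    then have "t > 0" using \<open>K / e > 0\<close> by simp
    have K: "K \<le> t * e" using t k(2) by (simp add: field_simps)
    have lt: "x / t < e" if "x < K" for x
      using that K \<open>t > 0\<close> by (simp add: field_simps)
    have "(1 / t) *\<^sub>R v j \<in> N" for j
      using vK[of j] k(3) \<open>t > 0\<close> lt
      by (intro subsetD[OF k(3)]) (auto simp: prod_ball_def hist_ball_def mem_Times_iff)
    then show "range v \<subseteq> (\<lambda>x. t *\<^sub>R x) ` N"
      using \<open>t > 0\<close> by (auto intro!: image_eqI[of _ _ "(1 / t) *\<^sub>R v _"])
  qed
qed

text \<open>On a general bounded set, strict pointwise inequalities leave no uniform margin. The
  intermediate \<open>d < r\<close> leaves \<open>r - d\<close>, half of which is spent on moving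
  \<open>T\<close>.\<close>

lemma openin_Lc_uniform_ball:
  fixes A :: "'a::topological_real_vector \<Rightarrow> 'b::real_normed_vector"
  assumes "tvs_bounded B"
  shows "openin Lc_topology {T \<in> continuous_linear_maps. \<exists>d<r. \<forall>x\<in>B. norm (T x - A x) \<le> d}"
  unfolding openin_Lc_topology Lc_open_def
proof (intro conjI ballI)
  fix T assume "T \<in> {T \<in> continuous_linear_maps. \<exists>d<r. \<forall>x\<in>B. norm (T x - A x) \<le> d}"
  then obtain d where d: "d < r" "\<And>x. x \<in> B \<Longrightarrow> norm (T x - A x) \<le> d" by blast
  have "norm (T' x - A x) \<le> (d + r) / 2" if "T' x - T x \<in> ball 0 ((r - d) / 2)" "x \<in> B" for T' x
    using that d(2)[OF that(2)] norm_triangle_ineq[of "T' x - T x" "T x - A x"]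
    by (simp add: field_simps)
  moreover have "(d + r) / 2 < r" using d by simp
  ultimately have "{T' \<in> continuous_linear_maps. \<forall>x\<in>B. T' x - T x \<in> ball 0 ((r - d) / 2)}
      \<subseteq> {T \<in> continuous_linear_maps. \<exists>d<r. \<forall>x\<in>B. norm (T x - A x) \<le> d}"
    by blast
  with assms d(1) show "\<exists>B' N. tvs_bounded B' \<and> open N \<and> 0 \<in> N \<and>
      {T' \<in> continuous_linear_maps. \<forall>x\<in>B'. T' x - T x \<in> N}
      \<subseteq> {T \<in> continuous_linear_maps. \<exists>d<r. \<forall>x\<in>B. norm (T x - A x) \<le> d}"
    by (intro exI[of _ B] exI[of _ "ball 0 ((r - d) / 2)"]) auto
qed auto

lemma C1_F_locally_bounded:
  fixes h :: "real \<times> 'a::real_normed_vector hist \<Rightarrow> 'b::real_normed_vector"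
  assumes h: "C1_F V h" and u: "u \<in> V"
  shows "\<exists>k e. 0 \<le> k \<and> 0 < e \<and> prod_ball k e u \<subseteq> V \<and>
    (\<forall>w\<in>prod_ball k e u. \<forall>v\<in>prod_ball k e 0. norm (dir_deriv h w v) \<le> 1)"
proof (rule ccontr)
  \<comment> \<open>Otherwise there are \<open>w j\<close> tending to \<open>u\<close> and \<open>v j\<close> tending to \<open>0\<close> with \<open>dir_deriv h (w j) (v j)\<close>
    large; this contradicts uniform convergence on the range of \<open>v\<close>, which is bounded.\<close>
  assume contra: "\<not> ?thesis"
  have "open V" and lin: "dir_deriv h u \<in> continuous_linear_maps"
    and cont: "continuous_map (top_of_set V) Lc_topology (dir_deriv h)"
    using h u by (auto simp: C1_F_def)
  obtain k0 e0 where 0: "0 \<le> k0" "0 < e0" "prod_ball k0 e0 u \<subseteq> V"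
    using open_contains_prod_ball[OF \<open>open V\<close> u] by blast
  have "\<exists>w v. w \<in> prod_ball (real j) (1 / real (Suc j)) u \<and>
      v \<in> prod_ball (real j) (1 / real (Suc j)) 0 \<and> norm (dir_deriv h w v) > 1" for j
  proof -
    \<comment> \<open>The maximum and minimum keep the ball inside \<open>V\<close>, so that the
      negated claim can only fail through a large derivative.\<close>
    define k e where "k = max k0 (real j)" and "e = min e0 (1 / real (Suc j))"
    have "prod_ball k e u \<subseteq> V"
      using 0(3) prod_ball_mono[of k0 k e e0 u] by (auto simp: k_def e_def)
    moreover have "0 \<le> k" "0 < e" using 0 by (auto simp: k_def e_def)
    ultimately obtain w v where "w \<in> prod_ball k e u" "v \<in> prod_ball k e 0" "norm (dir_deriv h w v) > 1"
      using contra by (meson not_le)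
    moreover have "prod_ball k e x \<subseteq> prod_ball (real j) (1 / real (Suc j)) x" for x :: "real \<times> 'a hist"
      by (rule prod_ball_mono) (auto simp: k_def e_def)
    ultimately show ?thesis by blast
  qed
  then obtain w v where w: "\<And>j. w j \<in> prod_ball (real j) (1 / real (Suc j)) u"
    and v: "\<And>j. v j \<in> prod_ball (real j) (1 / real (Suc j)) 0"
    and large: "\<And>j. norm (dir_deriv h (w j) (v j)) > 1" by metis
  have eventually_in: "\<forall>\<^sub>F j in sequentially. x j \<in> S"
    if x: "\<And>j. x j \<in> prod_ball (real j) (1 / real (Suc j)) a" and S: "open S" "a \<in> S"
    for x :: "nat \<Rightarrow> real \<times> 'a hist" and a S
  proof -
    obtain k e where k: "0 \<le> k" "0 < e" "prod_ball k e a \<subseteq> S"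
      using open_contains_prod_ball[OF S] by blast
    have "\<forall>\<^sub>F j in sequentially. k \<le> real j"
      using filterlim_real_sequentially by (simp add: filterlim_at_top)
    moreover have "\<forall>\<^sub>F j in sequentially. 1 / real (Suc j) < e"
      using LIMSEQ_Suc[OF lim_1_over_n] k(2) by (rule order_tendstoD(2))
    ultimately show ?thesis
    proof eventually_elim
      case (elim j)
      then show ?case using x[of j] k(3) prod_ball_mono[of k "real j" "1 / real (Suc j)" e a] by auto
    qed
  qed
  \<comment> \<open>The two halves add up to less than 1: a deviation below \<open>1 / 2\<close>
    from the derivative at \<open>u\<close>, and a value of that derivative at \<open>v j\<close>
    below \<open>1 / 2\<close>.\<close>
  define W where "W = {T \<in> continuous_linear_maps. \<exists>d<1 / 2. \<forall>x\<in>range v. norm (T x - dir_deriv h u x) \<le> d}"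
  have "openin (top_of_set V) {x \<in> V. dir_deriv h x \<in> W}"
    using openin_continuous_map_preimage[OF cont
        openin_Lc_uniform_ball[OF tvs_bounded_range_null[OF v], of "1 / 2" "dir_deriv h u"]]
    unfolding W_def by simp
  then have "open {x \<in> V. dir_deriv h x \<in> W}"
    using \<open>open V\<close> openin_open_trans by blast
  moreover have "u \<in> {x \<in> V. dir_deriv h x \<in> W}"
    using u lin by (auto simp: W_def intro: exI[of _ 0])
  ultimately have ev1: "\<forall>\<^sub>F j in sequentially. w j \<in> {x \<in> V. dir_deriv h x \<in> W}"
    by (rule eventually_in[OF w])
  have "open (dir_deriv h u -` ball 0 (1 / 2))"
    using lin by (intro open_vimage open_ball) (simp add: continuous_linear_maps_def)
  moreover have "0 \<in> dir_deriv h u -` ball 0 (1 / 2)"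
    by (simp add: dir_deriv_eqI[OF has_dir_deriv_zero])
  ultimately have ev2: "\<forall>\<^sub>F j in sequentially. v j \<in> dir_deriv h u -` ball 0 (1 / 2)"
    by (rule eventually_in[OF v])
  have "\<forall>\<^sub>F j in sequentially. False"
    using ev1 ev2
  proof eventually_elim
    case (elim j)
    then obtain d where "d < 1 / 2" "norm (dir_deriv h (w j) (v j) - dir_deriv h u (v j)) \<le> d"
      by (auto simp: W_def)
    moreover have "norm (dir_deriv h u (v j)) < 1 / 2" using elim by simp
    ultimately show False
      using large[of j] norm_triangle_sub[of "dir_deriv h (w j) (v j)" "dir_deriv h u (v j)"] by linarith
  qed
  then show False by simp
qed


lemma smooth_imp_lipschitz:
  fixes h :: "real \<times> 'a::real_normed_vector hist \<Rightarrow> 'b::real_normed_vector"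
  assumes h: "C1_MB V h \<or> C1_F V h" and u: "u \<in> V"
  shows "\<exists>k e L. 0 \<le> k \<and> 0 < e \<and> 0 \<le> L \<and> prod_ball k e u \<subseteq> V \<and>
    (\<forall>v\<in>prod_ball k e u. \<forall>w\<in>prod_ball k e u. \<forall>M\<ge>0. dist (fst v) (fst w) \<le> M \<longrightarrow>
      (\<forall>s\<in>{-k..0}. dist (happ (snd v) s) (happ (snd w) s) \<le> M) \<longrightarrow> dist (h v) (h w) \<le> L * M)"
proof -
  obtain k e where k: "0 \<le> k" "0 < e" and sub: "prod_ball k e u \<subseteq> V"
    and bound: "\<And>w v. w \<in> prod_ball k e u \<Longrightarrow> v \<in> prod_ball k e 0 \<Longrightarrow> norm (dir_deriv h w v) \<le> 1"
    using C1_MB_locally_bounded[OF _ u, of h] C1_F_locally_bounded[OF _ u, of h] h by blast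
  have diff: "has_dir_deriv h w v (dir_deriv h w v)" if "w \<in> prod_ball k e u" for w v
    using h sub that by (intro has_dir_deriv_dir_deriv) (unfold C1_MB_def C1_F_def, blast)
  have "dist (h v) (h w) \<le> 2 / e * M"
    if "v \<in> prod_ball k e u" "w \<in> prod_ball k e u" "0 \<le> M" "dist (fst v) (fst w) \<le> M"
      "\<forall>s\<in>{-k..0}. dist (happ (snd v) s) (happ (snd w) s) \<le> M" for v w M
    by (rule locally_bounded_imp_lipschitz[OF k(2) diff bound that(1-4)]) (use that(5) in auto)
  then show ?thesis
    using k sub by (intro exI[of _ k] exI[of _ e] exI[of _ "2 / e"] conjI) auto
qed

subsection \<open>The process\<close>

lemma happ_hist_fst: "s \<le> 0 \<Longrightarrow> happ (hist_fst \<psi>) s = fst (happ \<psi> s)"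
  and happ_hist_snd: "s \<le> 0 \<Longrightarrow> happ (hist_snd \<psi>) s = snd (happ \<psi> s)"
  and happ_hist_pair: "s \<le> 0 \<Longrightarrow> happ (hist_pair \<phi> \<xi>) s = (happ \<phi> s, happ \<xi> s)"
  and happ_time_hist: "s \<le> 0 \<Longrightarrow> happ (time_hist t) s = t + s"
  unfolding hist_fst_def hist_snd_def hist_pair_def time_hist_def
  by (subst happ_to_hist; auto intro!: continuous_intros continuous_on_happ)+

lemma hist_pair_fst_snd: "hist_pair (hist_fst \<psi>) (hist_snd \<psi>) = \<psi>"
  by (rule hist_eqI) (simp add: happ_hist_pair happ_hist_fst happ_hist_snd)

lemma hist_fst_pair: "hist_fst (hist_pair \<phi> \<xi>) = \<phi>"
  and hist_snd_pair: "hist_snd (hist_pair \<phi> \<xi>) = \<xi>"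
  by (rule hist_eqI; simp add: happ_hist_pair happ_hist_fst happ_hist_snd)+

lemma hist_pair_in_U_g: "hist_pair (time_hist t) \<phi> \<in> U_g V \<longleftrightarrow> (t, \<phi>) \<in> V"
  by (simp add: U_g_def hist_fst_pair hist_snd_pair happ_time_hist)

text \<open>The map \<open>\<pi>\<close> does not increase distances: components are dominated by
  the product norm, and evaluation at 0 is covered because \<open>0 \<le> k\<close> puts 0 into
  \<open>{-k..0}\<close>. The constant first component of \<open>f_g\<close> adds nothing to the
  distance of values.\<close>

lemma locally_lipschitz_f_g:
  fixes g :: "real \<times> (real ^ 'n) hist \<Rightarrow> real ^ 'n"
  assumes g: "C1_MB V g \<or> C1_F V g"
  shows "locally_lipschitz_delay (U_g V) (f_g g)"
proof
  fix \<psi> :: "(real \<times> (real ^ 'n)) hist" assume "\<psi> \<in> U_g V"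
  define \<pi> where "\<pi> \<psi> = (happ (hist_fst \<psi>) 0, hist_snd \<psi>)" for \<psi> :: "(real \<times> (real ^ 'n)) hist"
  have "\<pi> \<psi> \<in> V" using \<open>\<psi> \<in> U_g V\<close> by (simp add: U_g_def \<pi>_def)
  then obtain k e L where k: "0 \<le> k" "0 < e" "0 \<le> L" "prod_ball k e (\<pi> \<psi>) \<subseteq> V"
    and L: "\<And>v w M. \<lbrakk>v \<in> prod_ball k e (\<pi> \<psi>); w \<in> prod_ball k e (\<pi> \<psi>); 0 \<le> M; dist (fst v) (fst w) \<le> M;
      \<forall>s\<in>{-k..0}. dist (happ (snd v) s) (happ (snd w) s) \<le> M\<rbrakk> \<Longrightarrow> dist (g v) (g w) \<le> L * M"
    using smooth_imp_lipschitz[OF g] by metis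
  have dist\<pi>: "dist (fst (\<pi> \<phi>)) (fst (\<pi> \<xi>)) \<le> dist (happ \<phi> 0) (happ \<xi> 0)"
    "s \<le> 0 \<Longrightarrow> dist (happ (snd (\<pi> \<phi>)) s) (happ (snd (\<pi> \<xi>)) s) \<le> dist (happ \<phi> s) (happ \<xi> s)" for \<phi> \<xi> s
    by (simp_all add: \<pi>_def happ_hist_fst happ_hist_snd dist_fst_le dist_snd_le)
  have ball: "\<pi> \<phi> \<in> prod_ball k e (\<pi> \<psi>)" if "\<phi> \<in> hist_ball k e \<psi>" for \<phi>
    unfolding prod_ball_def mem_Times_iff
  proof
    show "fst (\<pi> \<phi>) \<in> ball (fst (\<pi> \<psi>)) e"
      using le_less_trans[OF dist\<pi>(1) hist_ballD[OF that, of 0]] k(1) by (simp add: dist_commute)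
    show "snd (\<pi> \<phi>) \<in> hist_ball k e (snd (\<pi> \<psi>))"
      unfolding hist_ball_def using le_less_trans[OF dist\<pi>(2) hist_ballD[OF that]] by auto
  qed
  have "hist_ball k e \<psi> \<subseteq> U_g V"
    using ball k(4) by (auto simp: U_g_def \<pi>_def)
  moreover have "dist (f_g g \<phi>) (f_g g \<xi>) \<le> L * M"
    if "\<phi> \<in> hist_ball k e \<psi>" "\<xi> \<in> hist_ball k e \<psi>"
      and M: "\<forall>s\<in>{-k..0}. dist (happ \<phi> s) (happ \<xi> s) \<le> M" for \<phi> \<xi> M
  proof -
    have M0: "dist (happ \<phi> 0) (happ \<xi> 0) \<le> M" using M k(1) by auto
    have "dist (g (\<pi> \<phi>)) (g (\<pi> \<xi>)) \<le> L * M"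
    proof (rule L[OF ball[OF that(1)] ball[OF that(2)]])
      show "0 \<le> M" using M0 zero_le_dist order_trans by blast
      show "dist (fst (\<pi> \<phi>)) (fst (\<pi> \<xi>)) \<le> M" using dist\<pi>(1) M0 by (rule order_trans)
      show "\<forall>s\<in>{-k..0}. dist (happ (snd (\<pi> \<phi>)) s) (happ (snd (\<pi> \<xi>)) s) \<le> M"
        using order_trans[OF dist\<pi>(2)] M by auto
    qed
    then show ?thesis by (simp add: f_g_def \<pi>_def dist_Pair_Pair)
  qed
  ultimately show "\<exists>k e L. 0 \<le> k \<and> 0 < e \<and> 0 \<le> L \<and> hist_ball k e \<psi> \<subseteq> U_g V \<and>
    (\<forall>\<phi>\<in>hist_ball k e \<psi>. \<forall>\<xi>\<in>hist_ball k e \<psi>. \<forall>M.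
      (\<forall>s\<in>{-k..0}. dist (happ \<phi> s) (happ \<xi> s) \<le> M) \<longrightarrow> dist (f_g g \<phi>) (f_g g \<xi>) \<le> L * M)"
    using k by blast
qed

lemma semiflow_time_component:
  assumes "locally_lipschitz_delay (U_g V) (f_g g)"
    and dom: "(r, hist_pair (time_hist t) \<phi>) \<in> semiflow_domain (U_g V) (f_g g)"
  shows "hist_fst (semiflow (U_g V) (f_g g) (r, hist_pair (time_hist t) \<phi>)) = time_hist (t + r)"
proof -
  interpret locally_lipschitz_delay "U_g V" "f_g g" by fact
  obtain z where r: "0 \<le> r" and z: "delay_solution (U_g V) (f_g g) {0..r} z"
    "segment z 0 = hist_pair (time_hist t) \<phi>"
    "semiflow (U_g V) (f_g g) (r, hist_pair (time_hist t) \<phi>) = segment z r"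
    using semiflow_domainE[OF dom] by metis
  note Z = z(1)[unfolded delay_solution_Icc[OF r]]
  have neg: "fst (z s) = t + s" if "s \<le> 0" for s
  proof -
    have "z s = (t + s, happ \<phi> s)"
      using happ_segment[of r z 0 s] Z r that z(2) by (simp add: happ_hist_pair happ_time_hist)
    then show ?thesis by simp
  qed
  have "fst (z s) = t + s" if "0 \<le> s" "s \<le> r" for s
  proof -
    \<comment> \<open>The mean value bound with constant 0: \<open>fst (z s) - s\<close> has
      derivative \<open>1 - 1\<close>.\<close>
    have "norm ((fst (z s) - s) - (fst (z 0) - 0)) \<le> 0 * \<bar>s - 0\<bar>"
    proof (rule has_vector_derivative_bound[of "{0..r}"])
      fix x assume x: "x \<in> {0..r}"
      have "(z has_vector_derivative f_g g (segment z x)) (at x within {0..r})"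
        using Z x by blast
      from bounded_linear.has_vector_derivative[OF bounded_linear_fst this]
      have "((\<lambda>s. fst (z s)) has_vector_derivative 1) (at x within {0..r})"
        by (simp add: f_g_def)
      from has_vector_derivative_diff[OF this has_vector_derivative_id]
      show "((\<lambda>s. fst (z s) - s) has_vector_derivative 0) (at x within {0..r})"
        by simp
    qed (use that r in auto)
    with neg[of 0] show ?thesis by simp
  qed
  with neg have all: "fst (z s) = t + s" if "s \<le> r" for s
    using that by (cases "s \<le> 0") auto
  show ?thesis
    unfolding z(3)
    by (rule hist_eqI) (use happ_segment[of r z r] Z all in \<open>simp add: happ_hist_fst happ_time_hist\<close>)
qed

theorem corollary6p3:
  fixes V :: "(real \<times> (real ^ 'n) hist) set"
    and g :: "real \<times> (real ^ 'n) hist \<Rightarrow> real ^ 'n"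
  assumes "open V"
    and "C1_MB V g \<or> C1_F V g"
  shows "\<forall>t\<^sub>0 \<phi>. (t\<^sub>0, \<phi>) \<in> V \<longrightarrow>
    (t\<^sub>0, t\<^sub>0, \<phi>) \<in> process_dom V g \<and>
    process V g (t\<^sub>0, t\<^sub>0, \<phi>) = \<phi> \<and>
    (\<forall>t s. t\<^sub>0 \<le> t \<and> t \<le> s \<and>
      (t, t\<^sub>0, \<phi>) \<in> process_dom V g \<and>
      (s, t, process V g (t, t\<^sub>0, \<phi>)) \<in> process_dom V g \<longrightarrow>
      (s, t\<^sub>0, \<phi>) \<in> process_dom V g \<and>
      process V g (s, t\<^sub>0, \<phi>) = process V g (s, t, process V g (t, t\<^sub>0, \<phi>)))"
proof (intro allI impI)
  fix t\<^sub>0 \<phi> assume "(t\<^sub>0, \<phi>) \<in> V"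
  note lip = locally_lipschitz_f_g[OF assms(2)]
  interpret locally_lipschitz_delay "U_g V" "f_g g" by (rule lip)
  let ?\<psi> = "hist_pair (time_hist t\<^sub>0) \<phi>"
  have "?\<psi> \<in> U_g V" using \<open>(t\<^sub>0, \<phi>) \<in> V\<close> by (simp add: hist_pair_in_U_g)
  note zero = semiflow_zero[OF this]
  have add: "(s, t\<^sub>0, \<phi>) \<in> process_dom V g \<and>
      process V g (s, t\<^sub>0, \<phi>) = process V g (s, t, process V g (t, t\<^sub>0, \<phi>))"
    if ts: "t\<^sub>0 \<le> t" "t \<le> s" and t: "(t, t\<^sub>0, \<phi>) \<in> process_dom V g"
      and s: "(s, t, process V g (t, t\<^sub>0, \<phi>)) \<in> process_dom V g" for t s
  proof -
    have 1: "(t - t\<^sub>0, ?\<psi>) \<in> semiflow_domain (U_g V) (f_g g)"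
      using t by (simp add: process_dom_def \<Omega>_g_def)
    have "hist_fst (semiflow (U_g V) (f_g g) (t - t\<^sub>0, ?\<psi>)) = time_hist t"
      using semiflow_time_component[OF lip 1] by simp
    \<comment> \<open>The process forgets the time component; as that is known to be
      \<open>time_hist t\<close>, pairing recovers the full state, which is the initial value of the
      restarted process.\<close>
    then have flow: "hist_pair (time_hist t) (process V g (t, t\<^sub>0, \<phi>))
        = semiflow (U_g V) (f_g g) (t - t\<^sub>0, ?\<psi>)"
      using hist_pair_fst_snd[of "semiflow (U_g V) (f_g g) (t - t\<^sub>0, ?\<psi>)"]
      by (simp add: process_def \<Sigma>_g_def)
    then have 2: "(s - t, semiflow (U_g V) (f_g g) (t - t\<^sub>0, ?\<psi>)) \<in> semiflow_domain (U_g V) (f_g g)"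
      using s by (simp add: process_dom_def \<Omega>_g_def)
    have "process V g (s, t, process V g (t, t\<^sub>0, \<phi>))
        = hist_snd (semiflow (U_g V) (f_g g) (s - t, semiflow (U_g V) (f_g g) (t - t\<^sub>0, ?\<psi>)))"
      using flow by (simp add: process_def[of V g] \<Sigma>_g_def)
    \<comment> \<open>The elapsed times \<open>t - t\<^sub>0\<close> and \<open>s - t\<close> add up
      to \<open>s - t\<^sub>0\<close>.\<close>
    then show ?thesis
      using semiflow_add[OF 1 2] ts by (simp add: process_dom_def \<Omega>_g_def process_def \<Sigma>_g_def)
  qed
  show "(t\<^sub>0, t\<^sub>0, \<phi>) \<in> process_dom V g \<and> process V g (t\<^sub>0, t\<^sub>0, \<phi>) = \<phi> \<and>
    (\<forall>t s. t\<^sub>0 \<le> t \<and> t \<le> s \<and> (t, t\<^sub>0, \<phi>) \<in> process_dom V g \<and>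
      (s, t, process V g (t, t\<^sub>0, \<phi>)) \<in> process_dom V g \<longrightarrow>
      (s, t\<^sub>0, \<phi>) \<in> process_dom V g \<and>
      process V g (s, t\<^sub>0, \<phi>) = process V g (s, t, process V g (t, t\<^sub>0, \<phi>)))"
  proof (intro conjI allI impI)
    show "(t\<^sub>0, t\<^sub>0, \<phi>) \<in> process_dom V g"
      using zero(1) by (simp add: process_dom_def \<Omega>_g_def)
    show "process V g (t\<^sub>0, t\<^sub>0, \<phi>) = \<phi>"
      using zero(2) by (simp add: process_def \<Sigma>_g_def hist_snd_pair)
  qed (use add in blast)+
qed

end
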